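(* Let $\sigma\in\{1,-1\}$, let $M_\sigma=\{y\in\mathbb R^3:\langle y,y\rangle=\sigma\}$ with the Riemannian metric induced by $\langle v,w\rangle=v_1w_1+v_2w_2+\sigma v_3w_3$, and let $A=\bar\beta B+\bar\gamma C$ where $\bar\beta,\bar\gamma\in\mathbb R$ are constants with $\bar\gamma\neq0$, $B(y)=(-y_2,y_1,0)$ and $C(y)=(0,0,1)-y_3y$ for $y\in M_\sigma$. Let $x=(x_1,x_2,x_3):\mathbb R\to M_\sigma$ be a $C^2$ curve satisfying $$\nabla_t x^{(1)}(t)=\tfrac12\,\mathrm{grad}\,\|A\|^2\,(x(t))+\theta^{-T}_{A,x^{(1)}(t)}\quad\text{for all }t\in\mathbb R,$$ and suppose $x_3$ is nonconstant. Put $b:=\sigma\|x^{(1)}(0)\|^2-(\bar\beta^2+\bar\gamma^2)(1-x_3(0)^2)$ and $c:=\sigma\big(x_1(0)x_2^{(1)}(0)-x_2(0)x_1^{(1)}(0)\big)-\bar\beta(1-x_3(0)^2)$, and $\bar\delta:=(2\bar\beta c-b-2\bar\gamma^2)/(3\bar\gamma^2)$. Then there exist $a\in\mathbb C$ and $\bar d\in\mathbb R$ such that, with $g_2=12\bar\delta^2+\bar d$ and $g_3=-8\bar\delta^3-\bar\delta\bar d$, $$x_3(t)=\pm\sqrt{\wp(\bar\gamma t+a;g_2,g_3)-\bar\delta}\quad\text{for all }t\in\mathbb R,$$ i.e. $x_3(t)^2=\wp(\bar\gamma t+a;g_2,g_3)-\bar\delta$, where $\wp(\cdot;g_2,g_3)$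 is the Weierstrass elliptic function with invariants $g_2,g_3$.
   Context: On $M_\sigma$ ($\sigma=1$: unit sphere $S^2$; $\sigma=-1$: two-sheeted unit hyperboloid $H^2$) the induced metric is Riemannian; $\|\cdot\|$ is its norm, $\nabla$ its Levi-Civita connection, $\nabla_t$ covariant differentiation along a curve, $\mathrm{grad}$ the Riemannian gradient, $x^{(1)}$ the derivative of $x$. The fields $B,C$ are tangent to $M_\sigma$. $A^T$ is the 1-form $Y\mapsto\langle A,Y\rangle$; for a tangent vector $X$ at $p$, $\theta_{A,X}$ is the covector $Y\mapsto(dA^T)(X,Y)=\langle\nabla_XA,Y\rangle-\langle\nabla_YA,X\rangle$ on $T_pM_\sigma$, and $\theta^{-T}_{A,X}\in T_pM_\sigma$ is defined by $\langle\theta^{-T}_{A,X},Y\rangle=\theta_{A,X}(Y)$ for all $Y\in T_pM_\sigma$. *)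

theory Defs
  imports "HOL-Analysis.Analysis" "HOL-Complex_Analysis.Complex_Analysis"
begin

text \<open>The Weierstrass function with invariants g2, g3 is the (unique) meromorphic function
  on the whole plane whose Laurent expansion at 0 is 1/z^2 + O(z^2) (i.e. P z - 1/z^2 tends to 0)
  and which satisfies P'^2 = 4 P^3 - g2 P - g3.  Convention (nicely_meromorphic_on):
  removable singularities are removed and the value at a pole is 0.\<close>

definition is_weierstrass_p :: "complex \<Rightarrow> complex \<Rightarrow> (complex \<Rightarrow> complex) \<Rightarrow> bool" where
  "is_weierstrass_p g2 g3 P \<longleftrightarrow>
     P nicely_meromorphic_on UNIV \<and>
     ((\<lambda>z. P z - 1 / z ^ 2) \<longlongrightarrow> 0) (at 0) \<and>
     (\<forall>z. \<not> is_pole P z \<longrightarrow> (deriv P z) ^ 2 = 4 * (P z) ^ 3 - g2 * P z - g3)"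

definition wp :: "complex \<Rightarrow> complex \<Rightarrow> complex \<Rightarrow> complex" where
  "wp g2 g3 = (THE P. is_weierstrass_p g2 g3 P)"

definition ip :: "real \<Rightarrow> real^3 \<Rightarrow> real^3 \<Rightarrow> real" where
  "ip \<sigma> v w = v$1 * w$1 + v$2 * w$2 + \<sigma> * v$3 * w$3"

definition Msig :: "real \<Rightarrow> (real^3) set" where
  "Msig \<sigma> = {y. ip \<sigma> y y = \<sigma>}"

definition tspace :: "real \<Rightarrow> real^3 \<Rightarrow> (real^3) set" where
  "tspace \<sigma> p = {v. ip \<sigma> p v = 0}"

text \<open>Orthogonal (w.r.t. ip) projection onto the tangent space at p; uses ip p p = sigma, sigma^2 = 1.\<close>
definition tproj :: "real \<Rightarrow> real^3 \<Rightarrow> real^3 \<Rightarrow> real^3" where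
  "tproj \<sigma> p v = v - (\<sigma> * ip \<sigma> p v) *\<^sub>R p"

text \<open>Levi-Civita connection of the induced metric: tangential part of the ambient derivative
  (the vector fields below are given by formulas on all of R^3).\<close>
definition cov :: "real \<Rightarrow> (real^3 \<Rightarrow> real^3) \<Rightarrow> real^3 \<Rightarrow> real^3 \<Rightarrow> real^3" where
  "cov \<sigma> V p X = tproj \<sigma> p (frechet_derivative V (at p) X)"

definition rgrad :: "real \<Rightarrow> (real^3 \<Rightarrow> real) \<Rightarrow> real^3 \<Rightarrow> real^3" where
  "rgrad \<sigma> f p = (THE v. v \<in> tspace \<sigma> p \<and>
      (\<forall>w \<in> tspace \<sigma> p. ip \<sigma> v w = frechet_derivative f (at p) w))"

definition theta :: "real \<Rightarrow> (real^3 \<Rightarrow> real^3) \<Rightarrow> real^3 \<Rightarrow> real^3 \<Rightarrow> real^3 \<Rightarrow> real" where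
  "theta \<sigma> A p X Y = ip \<sigma> (cov \<sigma> A p X) Y - ip \<sigma> (cov \<sigma> A p Y) X"

definition theta_sharp :: "real \<Rightarrow> (real^3 \<Rightarrow> real^3) \<Rightarrow> real^3 \<Rightarrow> real^3 \<Rightarrow> real^3" where
  "theta_sharp \<sigma> A p X = (THE v. v \<in> tspace \<sigma> p \<and>
      (\<forall>Y \<in> tspace \<sigma> p. ip \<sigma> v Y = theta \<sigma> A p X Y))"

definition Bfield :: "real^3 \<Rightarrow> real^3" where
  "Bfield y = vector [- (y$2), y$1, 0]"

definition Cfield :: "real^3 \<Rightarrow> real^3" where
  "Cfield y = vector [0, 0, 1] - (y$3) *\<^sub>R y"

definition Afield :: "real \<Rightarrow> real \<Rightarrow> real^3 \<Rightarrow> real^3" where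
  "Afield \<beta> \<gamma> y = \<beta> *\<^sub>R Bfield y + \<gamma> *\<^sub>R Cfield y"

end

theory Submission
  imports Defs
begin

text \<open>
  Writing z for the third coordinate of the curve, the energy b and the angular momentum c are
  conserved, and eliminating the other two coordinates gives
  z'' = 3 gamma^2 delta z + 2 gamma^2 z^3. Hence p(s) = z(s / gamma)^2 + delta satisfies
  p'' = 6 p^2 - g2 / 2 and p'^2 = 4 p^3 - g2 p - g3, and it remains to find a Weierstrass function
  with the same initial data.

  The Weierstrass function is constructed for arbitrary invariants, degenerate ones included,
  without lattices. Near 0 it is 1 / k^2, where k(0) = 0, k'(0) = 1 and
  k'^2 = 1 - g2/4 k^4 - g3/4 k^6; such a k is a local inverse of a primitive. The duplication
  formula, which expresses P(2z) rationally through P(z), then extends this germ to ever larger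
  discs. Every value w that is not a root of the cubic is attained: otherwise 1 / (P - w) would be
  a bounded entire function, because wherever P comes close to w it coincides with a local
  solution of the differential equation through w.
\<close>

subsection \<open>Autonomous equations of the form y'^2 = F(y)\<close>

text \<open>\<open>wp\<close> is a definite description, so existence and uniqueness must be known
  for the very invariants that the initial data produce. Their discriminant may vanish: integral
  curves of A are solutions, and on the sphere those with nonconstant z satisfy z' = gamma (1 -
  z^2), so that z is a hyperbolic tangent. In the nondegenerate case a lattice with prescribed
  invariants would have to be found. Duplication avoids both questions, being rational with
  coefficients that depend on the invariants alone.

  The first-order equation loses uniqueness at roots of the cubic. Hence the data are matched at a
  time where p' is nonzero, and agreement is propagated through the turning points by the
  second-order equation, whose right-hand side is locally Lipschitz. Poles are never met because p
  is finite on the whole line.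

  The shift by delta is forced: from z'^2 = gamma^2 (z^4 + 3 delta z^2 - d/4) one gets the cubic 4
  (p - delta)(p^2 + delta p - 2 delta^2 - d/4), whose quadratic term cancels and which has delta as
  a root.\<close>

lemma flow_primitive:
  fixes F :: "complex \<Rightarrow> complex"
  assumes F: "F holomorphic_on UNIV" and v: "v^2 = F w" "v \<noteq> 0"
  obtains \<rho> S T where "\<rho> > 0" "S w = v"
    "\<And>u. u \<in> ball w \<rho> \<Longrightarrow> S u \<noteq> 0 \<and> (S u)^2 = F u"
    "continuous_on (ball w \<rho>) S"
    "\<And>u. u \<in> ball w \<rho> \<Longrightarrow> (T has_field_derivative 1 / S u) (at u)"
    "inj_on T (ball w \<rho>)"
proof -
  have "isCont F w"
    using holomorphic_on_imp_continuous_on[OF F] by (simp add: continuous_on_eq_continuous_at)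
  then have "isCont (\<lambda>u. Re (F u / v^2)) w"
    using v(2) by (intro isCont_Re continuous_intros) auto
  moreover have "Re (F w / v^2) > 0" using v by (simp flip: v(1))
  ultimately have "\<forall>\<^sub>F u in at w. Re (F u / v^2) > 0"
    using order_tendstoD(1) unfolding isCont_def by blast
  then have "\<forall>\<^sub>F u in nhds w. Re (F u / v^2) > 0"
    using \<open>Re (F w / v^2) > 0\<close> by (simp add: eventually_nhds_conv_at)
  then obtain r where r: "r > 0" "\<And>u. u \<in> ball w r \<Longrightarrow> Re (F u / v^2) > 0"
    unfolding eventually_nhds_metric by (auto simp: dist_commute)
  \<comment> \<open>Division by \<open>v^2\<close> makes the radicand equal to 1 at
    \<open>w\<close>, so the principal root stays off its branch cut nearby, and the factor
    \<open>v\<close> selects the root with \<open>S w = v\<close>.\<close>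
  define S where "S = (\<lambda>u. v * csqrt (F u / v^2))"
  have nr: "F u / v^2 \<notin> \<real>\<^sub>\<le>\<^sub>0" if "u \<in> ball w r" for u
    using r(2)[OF that] by (auto simp: complex_nonpos_Reals_iff)
  have hS: "S holomorphic_on ball w r"
    unfolding S_def using v nr by (intro holomorphic_intros holomorphic_on_subset[OF F]) auto
  have S2: "S u \<noteq> 0 \<and> (S u)^2 = F u" if "u \<in> ball w r" for u
    using nr[OF that] v(2) by (auto simp: S_def power_mult_distrib)
  obtain T where T: "\<And>u. u \<in> ball w r \<Longrightarrow> (T has_field_derivative 1 / S u) (at u within ball w r)"
  proof (rule holomorphic_convex_primitive'[of "ball w r" "\<lambda>u. 1 / S u"])
    show "(\<lambda>u. 1 / S u) holomorphic_on ball w r"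
      using hS S2 by (intro holomorphic_intros) auto
  qed auto
  have T': "(T has_field_derivative 1 / S u) (at u)" if "u \<in> ball w r" for u
    using T[OF that] that by (simp add: at_within_open[OF that])
  have hT: "T holomorphic_on ball w r"
    using T' holomorphic_on_open by blast
  have "deriv T w \<noteq> 0"
    using DERIV_imp_deriv[OF T'[of w]] r(1) S2[of w] by auto
  then obtain \<rho> where "\<rho> > 0" "ball w \<rho> \<subseteq> ball w r" "inj_on T (ball w \<rho>)"
    using has_complex_derivative_locally_injective[OF hT, of w] r(1) by auto
  moreover have "S w = v" using v(2) by (simp add: S_def flip: v(1))
  moreover have "continuous_on (ball w \<rho>) S"
    using holomorphic_on_imp_continuous_on[OF hS] \<open>ball w \<rho> \<subseteq> ball w r\<close> by (rule continuous_on_subset)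
  ultimately show ?thesis
    by (intro that[of \<rho> S T]) (use S2 T' in \<open>auto simp: subset_iff\<close>)
qed

text \<open>Separation of variables: with \<open>S\<close> the branch of the square root of
  \<open>F\<close> that equals \<open>v\<close> at \<open>w\<close> and \<open>T\<close> a primitive
  of \<open>1 / S\<close>, the equation y' = S(y) reads T(y(z)) = z + const. The solution is the
  inverse of \<open>T\<close>, translated so that it passes through \<open>w\<close> at time
  0.\<close>

lemma flow_exists:
  fixes F :: "complex \<Rightarrow> complex"
  assumes F: "F holomorphic_on UNIV" and v: "v^2 = F w" "v \<noteq> 0"
  obtains q r where "r > 0" "q holomorphic_on ball 0 r" "q 0 = w" "deriv q 0 = v"
    "\<And>z. z \<in> ball 0 r \<Longrightarrow> deriv q z \<noteq> 0 \<and> (deriv q z)^2 = F (q z)"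
proof -
  obtain \<rho> S T where *: "\<rho> > 0" "S w = v"
    "\<And>u. u \<in> ball w \<rho> \<Longrightarrow> S u \<noteq> 0 \<and> (S u)^2 = F u"
    "\<And>u. u \<in> ball w \<rho> \<Longrightarrow> (T has_field_derivative 1 / S u) (at u)"
    "inj_on T (ball w \<rho>)"
    by (rule flow_primitive[OF assms]) blast
  have hT: "T holomorphic_on ball w \<rho>" using *(4) holomorphic_on_open by blast
  obtain g where g: "g holomorphic_on (T ` ball w \<rho>)"
    "\<And>z. z \<in> ball w \<rho> \<Longrightarrow> deriv T z * deriv g (T z) = 1"
    "\<And>z. z \<in> ball w \<rho> \<Longrightarrow> g (T z) = z"
    using holomorphic_has_inverse[OF hT _ *(5)] by auto
  have op: "open (T ` ball w \<rho>)" using open_mapping_thm3[OF hT _ *(5)] by simp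
  have dg: "deriv g (T z) = S z" if "z \<in> ball w \<rho>" for z
    using g(2)[OF that] *(3)[OF that] DERIV_imp_deriv[OF *(4)[OF that]] by (simp add: field_simps)
  have "T w \<in> T ` ball w \<rho>" using *(1) by simp
  then obtain r where r: "r > 0" "ball (T w) r \<subseteq> T ` ball w \<rho>"
    using op open_contains_ball by blast
  define q where "q = (\<lambda>z. g (z + T w))"
  have sh: "z + T w \<in> T ` ball w \<rho>" if "z \<in> ball 0 r" for z
    using that by (intro subsetD[OF r(2)]) (simp add: dist_norm)
  have hq: "q holomorphic_on ball 0 r"
    unfolding q_def
  proof (rule holomorphic_on_compose_gen[of "\<lambda>z. z + T w" _ g, unfolded o_def, OF _ g(1)])
    show "(\<lambda>z. z + T w) ` ball 0 r \<subseteq> T ` ball w \<rho>" using sh by (rule image_subsetI)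
  qed (intro holomorphic_intros)
  have dq: "deriv q z = deriv g (z + T w)" if "z \<in> ball 0 r" for z
  proof -
    have "(g has_field_derivative deriv g (z + T w)) (at (z + T w))"
      using holomorphic_derivI[OF g(1) op sh[OF that]] .
    then have "(q has_field_derivative deriv g (z + T w)) (at z)"
      unfolding q_def by (subst (asm) DERIV_shift)
    then show ?thesis by (rule DERIV_imp_deriv)
  qed
  show ?thesis
  proof (rule that[OF r(1) hq])
    show "q 0 = w" using g(3)[of w] *(1) by (simp add: q_def)
    show "deriv q 0 = v" using dq[of 0] r(1) dg[of w] *(1,2) by simp
    fix z :: complex assume z: "z \<in> ball 0 r"
    then obtain u where u: "u \<in> ball w \<rho>" "z + T w = T u" using sh[OF z] by (elim imageE) (rule that)
    show "deriv q z \<noteq> 0 \<and> (deriv q z)^2 = F (q z)"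
      using dq[OF z] u dg[OF u(1)] *(3)[OF u(1)] g(3)[OF u(1)] by (simp add: q_def)
  qed
qed

text \<open>Both solutions satisfy T(y(z)) = T(w) + (z - z0), and \<open>T\<close> is injective.
  Nonzero velocity is essential: y'^2 = 4 y is solved by both 0 and z^2.\<close>

lemma flow_unique:
  fixes F :: "complex \<Rightarrow> complex"
  assumes F: "F holomorphic_on UNIV"
    and y: "y1 analytic_on {z0}" "y2 analytic_on {z0}"
    and e: "\<forall>\<^sub>F z in nhds z0. (deriv y1 z)^2 = F (y1 z)" "\<forall>\<^sub>F z in nhds z0. (deriv y2 z)^2 = F (y2 z)"
    and i: "y1 z0 = y2 z0" "deriv y1 z0 = deriv y2 z0" "deriv y1 z0 \<noteq> 0"
  shows "\<forall>\<^sub>F z in nhds z0. y1 z = y2 z"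
proof -
  define w v where "w = y1 z0" and "v = deriv y1 z0"
  have v: "v^2 = F w" "v \<noteq> 0"
    using eventually_nhds_x_imp_x[OF e(1)] i by (auto simp: w_def v_def)
  obtain \<rho> S T where *: "\<rho> > 0" "S w = v"
    "\<And>u. u \<in> ball w \<rho> \<Longrightarrow> S u \<noteq> 0 \<and> (S u)^2 = F u"
    "continuous_on (ball w \<rho>) S"
    "\<And>u. u \<in> ball w \<rho> \<Longrightarrow> (T has_field_derivative 1 / S u) (at u)"
    "inj_on T (ball w \<rho>)"
    by (rule flow_primitive[OF F v]) blast
  have key: "\<forall>\<^sub>F z in nhds z0. y z \<in> ball w \<rho> \<and> T (y z) = T w + (z - z0)"
    if y: "y analytic_on {z0}" "\<forall>\<^sub>F z in nhds z0. (deriv y z)^2 = F (y z)" "y z0 = w" "deriv y z0 = v" for y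
  proof -
    have "isCont S w" using *(1,4) by (simp add: continuous_on_eq_continuous_at)
    have cy: "isCont y z0" using y(1) analytic_at_imp_isCont by blast
    have "isCont (\<lambda>z. S (y z)) z0" by (rule isCont_o2[OF cy]) (simp add: y(3) \<open>isCont S w\<close>)
    moreover have "isCont (deriv y) z0" using y(1) by (intro analytic_at_imp_isCont analytic_deriv)
    \<comment> \<open>\<open>S (y z)\<close> and \<open>deriv y z\<close> have equal squares. Their
      sum is 2v at \<open>z0\<close>, hence nonzero nearby, which rules out the opposite
      sign.\<close>
    ultimately have "isCont (\<lambda>z. S (y z) + deriv y z) z0" by (intro continuous_intros)
    moreover have "S (y z0) + deriv y z0 \<noteq> 0" using *(2) v y by auto
    ultimately have "\<forall>\<^sub>F z in nhds z0. S (y z) + deriv y z \<noteq> 0"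
      by (auto simp: eventually_nhds_conv_at isCont_def tendsto_imp_eventually_ne)
    moreover have "\<forall>\<^sub>F z in nhds z0. y z \<in> ball w \<rho>"
    proof -
      have "(y \<longlongrightarrow> y z0) (nhds z0)" using cy by (simp add: isCont_def tendsto_at_iff_tendsto_nhds)
      then show ?thesis by (rule topological_tendstoD) (use *(1) y(3) in auto)
    qed
    moreover have "\<forall>\<^sub>F z in nhds z0. y analytic_on {z}"
    proof -
      obtain A where A: "open A" "z0 \<in> A" "y holomorphic_on A" using y(1) by (auto simp: analytic_at)
      show ?thesis
        using eventually_nhds_in_open[OF A(1,2)] by eventually_elim (use A in \<open>auto simp: analytic_at\<close>)
    qed
    ultimately have "\<forall>\<^sub>F z in nhds z0. y z \<in> ball w \<rho> \<and> (y has_field_derivative S (y z)) (at z)"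
      using y(2)
    proof eventually_elim
      case (elim z)
      have "(S (y z))^2 = (deriv y z)^2" using *(3) elim by auto
      then have "S (y z) = deriv y z" using elim(1) by (auto simp: power2_eq_iff)
      then show ?case using elim by (simp add: analytic_derivI)
    qed
    then obtain r where r: "r > 0" "\<And>z. z \<in> ball z0 r \<Longrightarrow> y z \<in> ball w \<rho> \<and> (y has_field_derivative S (y z)) (at z)"
      unfolding eventually_nhds_metric by (auto simp: dist_commute)
    have "T (y z) = T w + (z - z0)" if z: "z \<in> ball z0 r" for z
    proof -
      have "((\<lambda>z. T (y z) - z) has_field_derivative 0) (at z within ball z0 r)" if "z \<in> ball z0 r" for z
      proof -
        have "((\<lambda>z. T (y z) - z) has_field_derivative (1 / S (y z) * S (y z) - 1)) (at z)"
          using r(2)[OF that] by (intro DERIV_diff DERIV_chain2[of T] *(5) DERIV_ident) auto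
        then show ?thesis using *(3) r(2)[OF that] by (simp add: has_field_derivative_at_within)
      qed
      then obtain c where "\<And>z. z \<in> ball z0 r \<Longrightarrow> T (y z) - z = c"
        using has_field_derivative_zero_constant[of "ball z0 r" "\<lambda>z. T (y z) - z"] by auto
      from this[OF z] this[of z0] have "T (y z) - z = T w - z0" using r(1) y(3) by simp
      then show ?thesis by (simp add: diff_eq_eq)
    qed
    then have "\<forall>z. dist z z0 < r \<longrightarrow> y z \<in> ball w \<rho> \<and> T (y z) = T w + (z - z0)"
      using r(2) by (simp add: dist_commute)
    then show ?thesis using r(1) unfolding eventually_nhds_metric by blast
  qed
  have "\<forall>\<^sub>F z in nhds z0. y1 z \<in> ball w \<rho> \<and> T (y1 z) = T w + (z - z0)"
    "\<forall>\<^sub>F z in nhds z0. y2 z \<in> ball w \<rho> \<and> T (y2 z) = T w + (z - z0)"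
    using key[OF y(1) e(1)] key[OF y(2) e(2)] i(1,2) by (simp_all add: w_def v_def)
  then show ?thesis
    by eventually_elim (rule inj_onD[OF *(6)]; simp)
qed

subsection \<open>Germs of the Weierstrass function\<close>

definition wcub :: "complex \<Rightarrow> complex \<Rightarrow> complex \<Rightarrow> complex" where
  "wcub g2 g3 y = 4 * y ^ 3 - g2 * y - g3"

text \<open>The duplication formula: the Weierstrass function P satisfies P (2 z) = wdup g2 g3 (P z).\<close>

definition wdup :: "complex \<Rightarrow> complex \<Rightarrow> complex \<Rightarrow> complex" where
  "wdup g2 g3 y = (y^4 + g2/2 * y^2 + 2 * g3 * y + g2^2/16) / wcub g2 g3 y"

text \<open>Substituting y = 1 / k^2 turns y'^2 = wcub g2 g3 y into k'^2 = wroot g2 g3 k, which is regular at k = 0.\<close>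

definition wroot :: "complex \<Rightarrow> complex \<Rightarrow> complex \<Rightarrow> complex" where
  "wroot g2 g3 u = 1 - g2/4 * u^4 - g3/4 * u^6"

text \<open>A germ at a double pole, normalised only by its leading coefficient. This is weaker than
  the condition in \<open>is_weierstrass_p\<close> and easier to preserve under duplication;
  \<open>wgerm_principal_part\<close> recovers the finer expansion from the differential
  equation.\<close>

definition wgerm :: "complex \<Rightarrow> complex \<Rightarrow> (complex \<Rightarrow> complex) \<Rightarrow> bool" where
  "wgerm g2 g3 Y \<longleftrightarrow> isolated_singularity_at Y 0 \<and> ((\<lambda>z. z^2 * Y z) \<longlongrightarrow> 1) (at 0) \<and>
     (\<forall>\<^sub>F z in at 0. (deriv Y z)^2 = wcub g2 g3 (Y z))"

text \<open>As z^2 Y(z) tends to 1, it has a holomorphic principal root near 0, and k = z / sqrt(z^2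
  Y) trades the double pole for a simple zero. Uniqueness of the pole germ thereby becomes a regular
  initial value problem with velocity 1.\<close>

lemma wgerm_root:
  assumes "wgerm g2 g3 Y"
  obtains k where "k analytic_on {0}" "k 0 = 0" "deriv k 0 = 1"
    "\<forall>\<^sub>F z in nhds 0. (deriv k z)^2 = wroot g2 g3 (k z)" "\<forall>\<^sub>F z in at 0. Y z = 1 / (k z)^2"
proof -
  have iso: "isolated_singularity_at Y 0" and lim: "((\<lambda>z. z^2 * Y z) \<longlongrightarrow> 1) (at 0)"
    and ode: "\<forall>\<^sub>F z in at 0. (deriv Y z)^2 = wcub g2 g3 (Y z)"
    using assms by (auto simp: wgerm_def)
  define m where "m = (\<lambda>z. if z = 0 then 1 else z^2 * Y z)"
  have "(\<lambda>z. z^2) analytic_on {0::complex}" by (intro analytic_intros)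
  then have "isolated_singularity_at (\<lambda>z. z^2 * Y z) 0"
    by (intro isolated_singularity_at_times iso isolated_singularity_at_analytic)
  then have am: "m analytic_on {0}"
    unfolding m_def by (rule removable_singularity') (use lim in simp)
  have m0: "m 0 = 1" by (simp add: m_def)
  have "isCont (\<lambda>z. Re (m z)) 0" using am by (intro isCont_Re analytic_at_imp_isCont)
  then have "((\<lambda>z. Re (m z)) \<longlongrightarrow> 1) (at 0)" unfolding isCont_def m0 by simp
  then have "\<forall>\<^sub>F z in at 0. Re (m z) > 0" by (rule order_tendstoD) simp
  then obtain r1 where r1: "r1 > 0" "\<And>z. z \<noteq> 0 \<Longrightarrow> cmod z < r1 \<Longrightarrow> Re (m z) > 0"
    unfolding eventually_at by auto
  obtain r2 where r2: "r2 > 0" "m holomorphic_on ball 0 r2"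
    using am by (auto simp: analytic_on_def)
  obtain r3 where r3: "r3 > 0" "Y analytic_on ball 0 r3 - {0}"
    using iso by (auto simp: isolated_singularity_at_def)
  obtain r4 where r4: "r4 > 0" "\<And>z. z \<noteq> 0 \<Longrightarrow> cmod z < r4 \<Longrightarrow> (deriv Y z)^2 = wcub g2 g3 (Y z)"
    using ode unfolding eventually_at by auto
  define r where "r = Min {r1, r2, r3, r4}"
  have r: "r > 0" "r \<le> r1" "r \<le> r2" "r \<le> r3" "r \<le> r4"
    using r1 r2 r3 r4 by (auto simp: r_def)
  have Rem: "Re (m z) > 0" if "cmod z < r" for z
    using r1(2)[of z] that r m0 by (cases "z = 0") auto
  have nr: "m z \<notin> \<real>\<^sub>\<le>\<^sub>0" "m z \<noteq> 0" if "cmod z < r" for z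
    using Rem[OF that] by (auto simp: complex_nonpos_Reals_iff)
  define k where "k = (\<lambda>z. z * (1 / csqrt (m z)))"
  have hm: "m holomorphic_on ball 0 r"
    by (rule holomorphic_on_subset[OF r2(2)]) (use r in auto)
  have hs: "(\<lambda>z. 1 / csqrt (m z)) holomorphic_on ball 0 r"
    by (intro holomorphic_intros hm) (use nr in auto)
  then have hk: "k holomorphic_on ball 0 r"
    unfolding k_def by (intro holomorphic_on_mult holomorphic_on_ident)
  have dk0: "deriv k 0 = 1"
  proof -
    have "((\<lambda>z. 1 / csqrt (m z)) has_field_derivative deriv (\<lambda>z. 1 / csqrt (m z)) 0) (at 0)"
      using hs r(1) by (intro holomorphic_derivI[of _ "ball 0 r"]) auto
    from DERIV_mult[OF DERIV_ident this]
    show ?thesis unfolding k_def by (intro DERIV_imp_deriv) (simp add: m0)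
  qed
  have k2: "(k z)^2 = 1 / Y z" "Y z \<noteq> 0" if "cmod z < r" "z \<noteq> 0" for z
    using nr[OF that(1)] that(2) by (auto simp: k_def m_def power_mult_distrib power_divide)
  have dk: "(deriv k z)^2 = wroot g2 g3 (k z)" if z: "cmod z < r" for z
  proof (cases "z = 0")
    case True
    then show ?thesis using dk0 by (simp add: wroot_def k_def)
  next
    case False
    have "Y analytic_on {z}" using r3(2) z False r by (auto intro: analytic_on_subset)
    then have "(Y has_field_derivative deriv Y z) (at z)" by (rule analytic_derivI)
    then have d1: "((\<lambda>z. 1 / Y z) has_field_derivative - deriv Y z / (Y z)^2) (at z)"
      using k2[OF z False] by (auto intro!: derivative_eq_intros simp: power2_eq_square)
    have "(k has_field_derivative deriv k z) (at z)"
      using hk z by (intro holomorphic_derivI[of _ "ball 0 r"]) auto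
    then have "((\<lambda>z. (k z)^2) has_field_derivative 2 * k z * deriv k z) (at z)"
      by (auto intro!: derivative_eq_intros)
    then have "((\<lambda>z. 1 / Y z) has_field_derivative 2 * k z * deriv k z) (at z)"
      by (rule has_field_derivative_transform_within_open[where S = "ball 0 r - {0}"])
         (use z False k2 in auto)
    \<comment> \<open>Two formulas for the derivative of 1/Y = k^2. After squaring, the equation for
      Y can be inserted, and the factor 4 k^2 cancels.\<close>
    from DERIV_unique[OF this d1] have "(2 * k z * deriv k z)^2 = (deriv Y z)^2 / (Y z)^4"
      by (simp add: power_divide flip: power_mult)
    also have "\<dots> = wcub g2 g3 (Y z) / (Y z)^4" using r4(2) z False r by simp
    finally have *: "(2 * k z * deriv k z)^2 = wcub g2 g3 (Y z) / (Y z)^4" .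
    have kn: "k z \<noteq> 0" using k2[OF z False] by auto
    have Yk: "Y z = 1 / (k z)^2" using k2[OF z False] by simp
    have "wcub g2 g3 (Y z) / (Y z)^4 = 4 * (k z)^2 - g2 * (k z)^6 - g3 * (k z)^8"
      unfolding Yk wcub_def using kn by (simp add: field_simps eval_nat_numeral)
    also have "\<dots> = 4 * (k z)^2 * wroot g2 g3 (k z)"
      by (simp add: wroot_def field_simps eval_nat_numeral)
    finally have "4 * (k z)^2 * (deriv k z)^2 = 4 * (k z)^2 * wroot g2 g3 (k z)"
      using * by (simp add: power_mult_distrib)
    then show ?thesis using kn by simp
  qed
  have nh: "\<forall>\<^sub>F z in nhds 0. cmod z < r"
    unfolding eventually_nhds_metric using r(1) by auto
  show ?thesis
  proof (rule that[of k])
    show "k analytic_on {0}" using hk r(1) by (auto simp: analytic_at intro!: exI[of _ "ball 0 r"])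
    show "\<forall>\<^sub>F z in nhds 0. (deriv k z)^2 = wroot g2 g3 (k z)"
      using nh by eventually_elim (rule dk)
    show "\<forall>\<^sub>F z in at 0. Y z = 1 / (k z)^2"
      unfolding eventually_at using r(1) k2 by (intro exI[of _ r]) auto
    show "k 0 = 0" by (simp add: k_def)
    show "deriv k 0 = 1" by (rule dk0)
  qed
qed

lemma holomorphic_wroot: "wroot g2 g3 holomorphic_on UNIV"
  unfolding wroot_def by (intro holomorphic_intros) auto

lemma wgerm_unique:
  assumes "wgerm g2 g3 Y1" "wgerm g2 g3 Y2"
  shows "\<forall>\<^sub>F z in at 0. Y1 z = Y2 z"
proof -
  obtain k1 where k1: "k1 analytic_on {0}" "k1 0 = 0" "deriv k1 0 = 1"
    "\<forall>\<^sub>F z in nhds 0. (deriv k1 z)^2 = wroot g2 g3 (k1 z)" "\<forall>\<^sub>F z in at 0. Y1 z = 1 / (k1 z)^2"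
    by (rule wgerm_root[OF assms(1)])
  obtain k2 where k2: "k2 analytic_on {0}" "k2 0 = 0" "deriv k2 0 = 1"
    "\<forall>\<^sub>F z in nhds 0. (deriv k2 z)^2 = wroot g2 g3 (k2 z)" "\<forall>\<^sub>F z in at 0. Y2 z = 1 / (k2 z)^2"
    by (rule wgerm_root[OF assms(2)])
  have "\<forall>\<^sub>F z in nhds 0. k1 z = k2 z"
    by (rule flow_unique[OF holomorphic_wroot k1(1) k2(1) k1(4) k2(4)]) (simp_all add: k1 k2)
  then have "\<forall>\<^sub>F z in at 0. k1 z = k2 z" by (simp add: eventually_nhds_conv_at)
  with k1(5) k2(5) show ?thesis by eventually_elim simp
qed

lemma root_quotient_limit:
  fixes k :: "complex \<Rightarrow> complex"
  assumes "k analytic_on {0}" "k 0 = 0" "deriv k 0 = 1"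
  shows "((\<lambda>z. k z / z) \<longlongrightarrow> 1) (at 0)"
  using analytic_derivI[OF assms(1), of UNIV] assms(2,3) by (simp add: has_field_derivative_iff)

text \<open>\<open>wroot\<close> has no terms of degree 1 to 3, so k' - 1 = O(z^4), k - z = O(z^5)
  and 1/k^2 - 1/z^2 = (z - k)(z + k) / (z^2 k^2) = O(z^2). Neither a 1/z term nor a constant term
  can occur.\<close>

lemma wgerm_principal_part:
  assumes "wgerm g2 g3 Y"
  shows "((\<lambda>z. Y z - 1 / z^2) \<longlongrightarrow> 0) (at 0)"
proof -
  obtain k where k: "k analytic_on {0}" "k 0 = 0" "deriv k 0 = 1"
    "\<forall>\<^sub>F z in nhds 0. (deriv k z)^2 = wroot g2 g3 (k z)" "\<forall>\<^sub>F z in at 0. Y z = 1 / (k z)^2"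
    by (rule wgerm_root[OF assms])
  have q: "((\<lambda>z. k z / z) \<longlongrightarrow> 1) (at 0)" by (rule root_quotient_limit[OF k(1-3)])
  have ck: "(k \<longlongrightarrow> 0) (at 0)" using analytic_at_imp_isCont[OF k(1)] k(2) by (simp add: isCont_def)
  have cd: "(deriv k \<longlongrightarrow> 1) (at 0)"
    using analytic_at_imp_isCont[OF analytic_deriv[OF k(1)]] k(3) by (simp add: isCont_def)
  \<comment> \<open>The quotient is (k' - 1) / z^4, obtained from (k' - 1)(k' + 1) = wroot(k) - 1.
    Its limit is -g2/8, whence the bound below.\<close>
  have "((\<lambda>z. - ((k z / z)^4 * (g2/4 + g3/4 * (k z)^2)) / (deriv k z + 1)) \<longlongrightarrow>
      - (1^4 * (g2/4 + g3/4 * 0^2)) / (1 + 1)) (at 0)"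
    by (intro tendsto_intros q ck cd) auto
  then have "\<forall>\<^sub>F z in at 0. cmod (- ((k z / z)^4 * (g2/4 + g3/4 * (k z)^2)) / (deriv k z + 1)) < cmod (g2/8) + 1"
    by (intro order_tendstoD(2)[OF tendsto_norm]) (auto simp: norm_divide)
  moreover have "\<forall>\<^sub>F z in at 0. deriv k z \<noteq> -1"
    by (rule tendsto_imp_eventually_ne[OF cd]) simp
  moreover have "\<forall>\<^sub>F z in at 0. (deriv k z)^2 = wroot g2 g3 (k z)"
    using k(4) by (simp add: eventually_nhds_conv_at)
  moreover have "\<forall>\<^sub>F z in at (0::complex). z \<noteq> 0" by (simp add: eventually_at_filter)
  ultimately have "\<forall>\<^sub>F z in at 0. cmod (deriv k z - 1) \<le> (cmod (g2/8) + 1) * cmod z ^ 4"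
  proof eventually_elim
    case (elim z)
    have "deriv k z + 1 \<noteq> 0" using elim(2) by (simp add: add_eq_0_iff2)
    moreover have "(deriv k z - 1) * (deriv k z + 1) = - ((k z)^4 * (g2/4 + g3/4 * (k z)^2))"
    proof -
      have "(deriv k z - 1) * (deriv k z + 1) = (deriv k z)^2 - 1" by (simp add: algebra_simps power2_eq_square)
      also have "\<dots> = - ((k z)^4 * (g2/4 + g3/4 * (k z)^2))"
      proof -
        have "1 - g2/4 * A - g3/4 * (A * B) - 1 = - (A * (g2/4 + g3/4 * B))" for A B :: complex
          by (simp add: algebra_simps)
        from this[of "(k z)^4" "(k z)^2"] show ?thesis
          unfolding elim(3) wroot_def by (simp flip: power_add)
      qed
      finally show ?thesis .
    qed
    ultimately have "deriv k z - 1 = - ((k z)^4 * (g2/4 + g3/4 * (k z)^2)) / (deriv k z + 1)"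
      by (rule nonzero_eq_divide_eq[THEN iffD2])
    also have "\<dots> = (- ((k z / z)^4 * (g2/4 + g3/4 * (k z)^2)) / (deriv k z + 1)) * z^4"
      using elim(4) by (simp add: power_divide)
    finally have "deriv k z - 1 = (- ((k z / z)^4 * (g2/4 + g3/4 * (k z)^2)) / (deriv k z + 1)) * z^4" .
    then have "cmod (deriv k z - 1) = cmod (- ((k z / z)^4 * (g2/4 + g3/4 * (k z)^2)) / (deriv k z + 1)) * cmod z ^ 4"
      by (metis norm_mult norm_power)
    then show ?case using elim(1) by (simp add: mult_right_mono)
  qed
  then obtain r1 where r1: "r1 > 0" "\<And>z. z \<noteq> 0 \<Longrightarrow> cmod z < r1 \<Longrightarrow> cmod (deriv k z - 1) \<le> (cmod (g2/8) + 1) * cmod z ^ 4"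
    unfolding eventually_at by auto
  obtain r2 where r2: "r2 > 0" "k holomorphic_on ball 0 r2"
    using k(1) by (auto simp: analytic_on_def)
  define C where "C = cmod (g2/8) + 1"
  have bd: "cmod (k z - z) \<le> C * cmod z ^ 5" if z: "cmod z < min r1 r2" for z
  proof -
    \<comment> \<open>Mean value estimate on the disc of radius |z|, where |k' - 1| is at most C
      |z|^4; this yields the fifth power.\<close>
    have "cmod ((k z - z) - (k 0 - 0)) \<le> (C * cmod z ^ 4) * cmod (z - 0)"
    proof (rule field_differentiable_bound[where S = "cball 0 (cmod z)" and f = "\<lambda>z. k z - z" and f' = "\<lambda>z. deriv k z - 1"])
      fix u :: complex assume u: "u \<in> cball 0 (cmod z)"
      have "(k has_field_derivative deriv k u) (at u)"
        using r2 u z by (intro holomorphic_derivI[of _ "ball 0 r2"]) auto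
      then show "((\<lambda>z. k z - z) has_field_derivative deriv k u - 1) (at u within cball 0 (cmod z))"
        by (intro has_field_derivative_at_within[OF DERIV_diff] DERIV_ident)
      have "cmod (deriv k u - 1) \<le> C * cmod u ^ 4"
        using r1(2)[of u] u z k(3) by (cases "u = 0") (auto simp: C_def)
      also have "\<dots> \<le> C * cmod z ^ 4"
        using u by (intro mult_left_mono power_mono) (auto simp: C_def)
      finally show "cmod (deriv k u - 1) \<le> C * cmod z ^ 4" .
    qed auto
    then show ?thesis using k(2) by (simp add: eval_nat_numeral mult_ac)
  qed
  have "((\<lambda>z. (z - k z) / z^3) \<longlongrightarrow> 0) (at 0)"
  proof (rule Lim_null_comparison)
    show "((\<lambda>z::complex. C * cmod z ^ 2) \<longlongrightarrow> 0) (at 0)"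
      by (auto intro!: tendsto_eq_intros)
    have "\<forall>\<^sub>F z in at (0::complex). cmod z < min r1 r2 \<and> z \<noteq> 0"
      unfolding eventually_at using r1(1) r2(1) by (intro exI[of _ "min r1 r2"]) auto
    then show "\<forall>\<^sub>F z in at 0. cmod ((z - k z) / z^3) \<le> C * cmod z ^ 2"
    proof eventually_elim
      case (elim z)
      then have "cmod ((z - k z) / z^3) \<le> C * cmod z ^ 5 / cmod z ^ 3"
        using bd[of z] by (simp add: norm_divide norm_power norm_minus_commute divide_right_mono)
      also have "\<dots> = C * cmod z ^ 2" using elim by (simp add: field_simps flip: power_add)
      finally show ?case .
    qed
  qed
  moreover have "((\<lambda>z. inverse (k z / z)) \<longlongrightarrow> inverse 1) (at 0)"
    by (intro tendsto_intros q) auto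
  ultimately have "((\<lambda>z. ((z - k z) / z^3) * (1 + k z / z) * (inverse (k z / z))^2) \<longlongrightarrow> 0 * (1 + 1) * (inverse 1)^2) (at 0)"
    by (intro tendsto_intros q) auto
  moreover have "\<forall>\<^sub>F z in at 0. ((z - k z) / z^3) * (1 + k z / z) * (inverse (k z / z))^2 = Y z - 1 / z^2"
  proof -
    have "\<forall>\<^sub>F z in at 0. k z / z \<noteq> 0" by (rule tendsto_imp_eventually_ne[OF q]) simp
    with k(5) show ?thesis
    proof eventually_elim
      case (elim z)
      then have nz: "z \<noteq> 0" "k z \<noteq> 0" by auto
      have "((z - k z) / z^3) * (1 + k z / z) * (inverse (k z / z))^2 = (z - k z) * (z + k z) * z^2 / (z^4 * (k z)^2)"
        using nz by (simp add: field_simps eval_nat_numeral)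
      also have "\<dots> = 1 / (k z)^2 - 1 / z^2" using nz by (simp add: field_simps eval_nat_numeral)
      finally show ?case using elim(1) by simp
    qed
  qed
  ultimately show ?thesis by (simp add: tendsto_cong)
qed

subsection \<open>Extension to the plane by duplication\<close>

lemma nicely_meromorphic_on_open_subset_cong:
  assumes "open A" "\<And>z. z \<in> A \<Longrightarrow> f z = g z" "g nicely_meromorphic_on A"
  shows "f nicely_meromorphic_on A"
proof -
  have ev: "\<forall>\<^sub>F w in at z. f w = g w" if "z \<in> A" for z
    using eventually_at_in_open'[OF assms(1) that] by eventually_elim (rule assms(2))
  have "f meromorphic_on A \<longleftrightarrow> g meromorphic_on A"
    by (rule meromorphic_on_cong) (use ev in auto)
  moreover have "is_pole f z \<longleftrightarrow> is_pole g z" if "z \<in> A" for z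
    by (rule is_pole_cong[OF ev[OF that] refl])
  moreover have "f \<midarrow>z\<rightarrow> f z \<longleftrightarrow> g \<midarrow>z\<rightarrow> g z" if "z \<in> A" for z
    using tendsto_cong[OF ev[OF that]] assms(2)[OF that] by simp
  ultimately show ?thesis using assms(2,3) by (simp add: nicely_meromorphic_on_def)
qed

lemma nicely_meromorphic_on_Union:
  assumes "\<And>A. A \<in> \<A> \<Longrightarrow> f nicely_meromorphic_on A"
  shows "f nicely_meromorphic_on \<Union>\<A>"
  using assms by (auto simp: nicely_meromorphic_on_def meromorphic_on_Union)

text \<open>The difference vanishes near \<open>z\<close>, hence, after removal of its
  singularities, on all of the connected set \<open>A\<close>. Equality of the values at
  \<open>w\<close> itself comes from niceness: at a common pole both are 0 by convention, elsewhere
  both functions are continuous.\<close>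

lemma nicely_meromorphic_identity:
  assumes f: "f nicely_meromorphic_on A" and g: "g nicely_meromorphic_on A"
    and A: "open A" "connected A" "z \<in> A" and ev: "\<forall>\<^sub>F w in at z. f w = g w"
    and w: "w \<in> A"
  shows "f w = g w"
proof -
  let ?d = "\<lambda>u. f u - g u"
  have md: "?d meromorphic_on A"
    using f g by (intro meromorphic_intros) (auto simp: nicely_meromorphic_on_def)
  have "\<forall>\<^sub>F u in at z. remove_sings ?d u = ?d u"
    using A(3) by (intro eventually_remove_sings_eq_at meromorphic_on_isolated_singularity[OF meromorphic_on_subset[OF md]]) simp
  with ev have "\<forall>\<^sub>F u in at z. remove_sings ?d u = 0" by eventually_elim simp
  then have "\<exists>\<^sub>F u in at z. remove_sings ?d u = 0" by (intro eventually_frequently) auto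
  then have z: "remove_sings ?d u = 0" if "u \<in> A" for u
    using frequently_eq_meromorphic_imp_constant[OF _ remove_sings_nicely_meromorphic[OF md] A] that by blast
  have "\<forall>\<^sub>F u in at w. remove_sings ?d u = ?d u"
    using w by (intro eventually_remove_sings_eq_at meromorphic_on_isolated_singularity[OF meromorphic_on_subset[OF md]]) simp
  with eventually_at_in_open'[OF A(1) w] have e: "\<forall>\<^sub>F u in at w. f u = g u"
    by eventually_elim (use z in auto)
  have p: "is_pole f w \<longleftrightarrow> is_pole g w" by (rule is_pole_cong[OF e refl])
  show ?thesis
  proof (cases "is_pole f w")
    case True
    then show ?thesis using p is_pole_zero_at_nicely_mero f g w by metis
  next
    case False
    then have "f \<midarrow>w\<rightarrow> f w" "g \<midarrow>w\<rightarrow> g w" using p f g w by (auto simp: nicely_meromorphic_on_def)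
    moreover have "f \<midarrow>w\<rightarrow> g w" using \<open>g \<midarrow>w\<rightarrow> g w\<close> tendsto_cong[OF e] by blast
    ultimately show ?thesis by (intro LIM_unique[of f]) auto
  qed
qed

section \<open>Existence of a germ and its stability under duplication\<close>

lemma wgerm_cong:
  assumes "wgerm g2 g3 Y" "\<forall>\<^sub>F z in at 0. X z = Y z"
  shows "wgerm g2 g3 X"
proof -
  have "\<forall>\<^sub>F z in at 0. (deriv Y z)^2 = wcub g2 g3 (Y z) \<longrightarrow> (deriv X z)^2 = wcub g2 g3 (X z)"
  proof -
    obtain r where r: "r > 0" "\<And>z. z \<noteq> 0 \<Longrightarrow> cmod z < r \<Longrightarrow> X z = Y z"
      using assms(2) unfolding eventually_at by auto
    have "deriv X z = deriv Y z" if z: "z \<noteq> 0" "cmod z < r" for z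
    proof (rule deriv_cong_ev)
      have "\<forall>\<^sub>F w in nhds z. w \<in> ball 0 r - {0}" using z by (intro eventually_nhds_in_open) auto
      then show "\<forall>\<^sub>F w in nhds z. X w = Y w" by eventually_elim (use r(2) in auto)
    qed simp
    then show ?thesis unfolding eventually_at using r by (intro exI[of _ r]) auto
  qed
  moreover have "isolated_singularity_at X 0 \<longleftrightarrow> isolated_singularity_at Y 0"
    by (rule isolated_singularity_at_cong[OF assms(2) refl])
  moreover have "((\<lambda>z. z^2 * X z) \<longlongrightarrow> 1) (at 0) \<longleftrightarrow> ((\<lambda>z. z^2 * Y z) \<longlongrightarrow> 1) (at 0)"
    by (rule tendsto_cong) (use assms(2) in \<open>eventually_elim, simp\<close>)
  ultimately show ?thesis using assms unfolding wgerm_def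
    by (auto elim: eventually_rev_mp)
qed

lemma wgerm_exists:
  obtains Y r where "r > 0" "Y meromorphic_on ball 0 r" "wgerm g2 g3 Y"
proof -
  obtain h r where h: "r > 0" "h holomorphic_on ball 0 r" "h 0 = 0" "deriv h 0 = 1"
    "\<And>z. z \<in> ball 0 r \<Longrightarrow> deriv h z \<noteq> 0 \<and> (deriv h z)^2 = wroot g2 g3 (h z)"
    by (rule flow_exists[OF holomorphic_wroot, of 1 g2 g3 0]) (auto simp: wroot_def)
  have ah: "h analytic_on {0}" using h(1,2) by (auto simp: analytic_at intro!: exI[of _ "ball 0 r"])
  have q: "((\<lambda>z. h z / z) \<longlongrightarrow> 1) (at 0)" by (rule root_quotient_limit[OF ah h(3,4)])
  define Y where "Y = (\<lambda>z. 1 / (h z)^2)"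
  have mY: "Y meromorphic_on ball 0 r"
    unfolding Y_def using h(2) by (intro meromorphic_intros analytic_on_imp_meromorphic_on) (simp add: analytic_on_open)
  have "wgerm g2 g3 Y"
    unfolding wgerm_def
  proof (intro conjI)
    show "isolated_singularity_at Y 0" 
      using h(1) by (intro meromorphic_on_isolated_singularity[OF meromorphic_on_subset[OF mY]]) simp
    have "((\<lambda>z. 1 / (h z / z)^2) \<longlongrightarrow> 1 / 1^2) (at 0)" by (intro tendsto_intros q) auto
    then show "((\<lambda>z. z^2 * Y z) \<longlongrightarrow> 1) (at 0)" by (simp add: Y_def power_divide)
    have "\<forall>\<^sub>F z in at 0. h z / z \<noteq> 0" by (rule tendsto_imp_eventually_ne[OF q]) simp
    moreover have "\<forall>\<^sub>F z in at 0. z \<in> ball 0 r" using h(1) by (intro eventually_at_in_open') auto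
    ultimately show "\<forall>\<^sub>F z in at 0. (deriv Y z)^2 = wcub g2 g3 (Y z)"
    proof eventually_elim
      case (elim z)
      then have nz: "h z \<noteq> 0" by auto
      have "(h has_field_derivative deriv h z) (at z)"
        using h(2) elim by (intro holomorphic_derivI[of _ "ball 0 r"]) auto
      then have "(Y has_field_derivative - 2 * deriv h z / (h z)^3) (at z)"
        unfolding Y_def using nz by (auto intro!: derivative_eq_intros simp: field_simps eval_nat_numeral)
      then have "(deriv Y z)^2 = 4 * (deriv h z)^2 / (h z)^6"
        by (simp add: DERIV_imp_deriv power_divide power_mult_distrib flip: power_mult)
      also have "\<dots> = wcub g2 g3 (Y z)"
        unfolding conjunct2[OF h(5)[OF elim(2)]] wroot_def wcub_def Y_def
        using nz by (simp add: field_simps eval_nat_numeral)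
      finally show ?case .
    qed
  qed
  then show ?thesis using that h(1) mY by blast
qed

text \<open>For W = N / f this is W'(y)^2 f / 4 = 4 W^3 - g2 W - g3 with denominators cleared. When
  Y'^2 = f(Y), the left-hand side is the squared derivative of W(Y(z/2)), so the identity carries
  the differential equation through duplication.\<close>

lemma wdup_cubic_identity:
  fixes y g2 g3 :: complex
  defines "N \<equiv> y^4 + g2/2 * y^2 + 2 * g3 * y + g2^2/16" and "f \<equiv> 4 * y^3 - g2 * y - g3"
  shows "((4 * y^3 + g2 * y + 2 * g3) * f - N * (12 * y^2 - g2))^2 = 4 * (4 * N^3 - g2 * N * f^2 - g3 * f^3)"
proof -
  \<comment> \<open>With g2 = 4a all coefficients of \<open>N\<close> become integers.\<close>
  define a where "a = g2 / 4"
  have g2: "g2 = 4 * a" by (simp add: a_def)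
  have N: "N = y^4 + 2 * a * y^2 + 2 * g3 * y + a^2" by (simp add: N_def g2 power_mult_distrib)
  show ?thesis unfolding N f_def g2 by algebra
qed

lemma wgerm_duplication:
  assumes "wgerm g2 g3 Y"
  shows "wgerm g2 g3 (\<lambda>z. wdup g2 g3 (Y (z / 2)))"
proof -
  have iso: "isolated_singularity_at Y 0" and lim: "((\<lambda>z. z^2 * Y z) \<longlongrightarrow> 1) (at 0)"
    and ode: "\<forall>\<^sub>F z in at 0. (deriv Y z)^2 = wcub g2 g3 (Y z)"
    using assms by (auto simp: wgerm_def)
  have half: "filterlim (\<lambda>z::complex. z / 2) (at 0) (at 0)"
    by (intro filterlim_atI tendsto_eq_intros) (auto simp: eventually_at_filter)
  \<comment> \<open>Numerator and denominator of \<open>wdup\<close>, divided by the fourth and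
    third power of Y and written through z^2 Y, whose limit is known. For large y the value of
    \<open>wdup\<close> behaves like y / 4, which compensates the factor 4 that comes from halving
    the argument.\<close>
  let ?N = "\<lambda>z. 1 + g2/2 * (z^2)^2 / (z^2 * Y z)^2 + 2 * g3 * (z^2)^3 / (z^2 * Y z)^3 + g2^2/16 * (z^2)^4 / (z^2 * Y z)^4"
  let ?D = "\<lambda>z. 4 - g2 * (z^2)^2 / (z^2 * Y z)^2 - g3 * (z^2)^3 / (z^2 * Y z)^3"
  have "((\<lambda>z. 4 * (z^2 * Y z) * ?N z / ?D z) \<longlongrightarrow> 4 * 1 * (1 + g2/2 * (0^2)^2 / 1^2 + 2 * g3 * (0^2)^3 / 1^3 + g2^2/16 * (0^2)^4 / 1^4)
      / (4 - g2 * (0^2)^2 / 1^2 - g3 * (0^2)^3 / 1^3)) (at 0)"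
    by (intro tendsto_intros lim) auto
  then have l0: "((\<lambda>z. 4 * (z^2 * Y z) * ?N z / ?D z) \<longlongrightarrow> 1) (at 0)" by simp
  have ldl: "(?D \<longlongrightarrow> 4 - g2 * (0^2)^2 / 1^2 - g3 * (0^2)^3 / 1^3) (at 0)"
    by (intro tendsto_intros lim) auto
  then have evD: "\<forall>\<^sub>F z in at 0. ?D z \<noteq> 0" by (rule tendsto_imp_eventually_ne) simp
  have evY: "\<forall>\<^sub>F z in at 0. z^2 * Y z \<noteq> 0" by (rule tendsto_imp_eventually_ne[OF lim]) simp
  have rew: "\<forall>\<^sub>F z in at 0. wcub g2 g3 (Y z) \<noteq> 0 \<and> (2 * z)^2 * wdup g2 g3 (Y z) = 4 * (z^2 * Y z) * ?N z / ?D z"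
    using evD evY
  proof eventually_elim
    case (elim z)
    then have nz: "z \<noteq> 0" "Y z \<noteq> 0" by auto
    have "wcub g2 g3 (Y z) = (Y z)^3 * ?D z"
      using nz by (simp add: wcub_def power_mult_distrib right_diff_distrib) (simp add: eval_nat_numeral)
    moreover have "(Y z)^4 + g2/2 * (Y z)^2 + 2 * g3 * Y z + g2^2/16 = (Y z)^4 * ?N z"
      using nz by (simp add: power_mult_distrib distrib_left) (simp add: eval_nat_numeral)
    ultimately show ?case using elim nz by (simp add: wdup_def power_mult_distrib) (simp add: eval_nat_numeral)
  qed
  have "((\<lambda>z. (2 * z)^2 * wdup g2 g3 (Y z)) \<longlongrightarrow> 1) (at 0)"
    using l0
  proof (rule Lim_transform_eventually)
    show "\<forall>\<^sub>F z in at 0. 4 * (z^2 * Y z) * ?N z / ?D z = (2 * z)^2 * wdup g2 g3 (Y z)"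
      using rew by eventually_elim (rule conjunct2[THEN sym])
  qed
  from filterlim_compose[OF this half] have L: "((\<lambda>z. z^2 * wdup g2 g3 (Y (z / 2))) \<longlongrightarrow> 1) (at 0)" by simp
  obtain r1 where r1: "r1 > 0" "Y analytic_on ball 0 r1 - {0}"
    using iso by (auto simp: isolated_singularity_at_def)
  have "\<forall>\<^sub>F z in at 0. z \<in> ball 0 r1 - {0}" using r1(1) by (intro eventually_at_in_open) auto
  with rew ode have "\<forall>\<^sub>F z in at 0. wcub g2 g3 (Y z) \<noteq> 0 \<and> (deriv Y z)^2 = wcub g2 g3 (Y z) \<and> Y analytic_on {z}"
    by eventually_elim (use r1(2) in \<open>auto intro: analytic_on_subset\<close>)
  from filterlim_iff[THEN iffD1, OF half, rule_format, OF this]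
  have ev: "\<forall>\<^sub>F z in at 0. (\<lambda>z. wdup g2 g3 (Y (z / 2))) field_differentiable at z \<and>
    (deriv (\<lambda>z. wdup g2 g3 (Y (z / 2))) z)^2 = wcub g2 g3 (wdup g2 g3 (Y (z / 2)))"
  proof eventually_elim
    case (elim z)
    define y y' f N where "y = Y (z / 2)" and "y' = deriv Y (z / 2)" and "f = wcub g2 g3 y"
      and "N = y^4 + g2/2 * y^2 + 2 * g3 * y + g2^2/16"
    have f0: "f \<noteq> 0" and y2: "y'^2 = f" using elim by (simp_all add: y_def y'_def f_def)
    have "(Y has_field_derivative y') (at (z / 2))" unfolding y'_def using elim by (intro analytic_derivI) auto
    then have dY: "((\<lambda>z. Y (z / 2)) has_field_derivative y' * (1 / 2)) (at z)"
      by (rule DERIV_chain2[where g = "\<lambda>z. z / 2"]) (auto intro!: derivative_eq_intros)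
    have "(wdup g2 g3 has_field_derivative ((4 * y^3 + g2 * y + 2 * g3) * f - N * (12 * y^2 - g2)) / (f * f)) (at y)"
      unfolding wdup_def[abs_def] f_def wcub_def N_def
      using f0 by (auto intro!: derivative_eq_intros simp: f_def wcub_def)
    then have "(wdup g2 g3 has_field_derivative ((4 * y^3 + g2 * y + 2 * g3) * f - N * (12 * y^2 - g2)) / (f * f)) (at (Y (z / 2)))"
      by (simp only: y_def)
    from DERIV_chain2[OF this dY] have d: "((\<lambda>z. wdup g2 g3 (Y (z / 2))) has_field_derivative
        ((4 * y^3 + g2 * y + 2 * g3) * f - N * (12 * y^2 - g2)) / (f * f) * (y' * (1 / 2))) (at z)" .
    have "(((4 * y^3 + g2 * y + 2 * g3) * f - N * (12 * y^2 - g2)) / (f * f) * (y' * (1 / 2)))^2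
        = ((4 * y^3 + g2 * y + 2 * g3) * f - N * (12 * y^2 - g2))^2 / (4 * f^3)"
      using f0 by (simp add: power_divide power_mult_distrib y2) (simp add: eval_nat_numeral)
    also have "((4 * y^3 + g2 * y + 2 * g3) * f - N * (12 * y^2 - g2))^2 = 4 * (4 * N^3 - g2 * N * f^2 - g3 * f^3)"
      unfolding N_def f_def wcub_def by (rule wdup_cubic_identity)
    also have "4 * (4 * N^3 - g2 * N * f^2 - g3 * f^3) / (4 * f^3) = (4 * N^3 - g2 * N * f^2 - g3 * f^3) / f^3"
      by (rule mult_divide_mult_cancel_left) simp
    also have "\<dots> = wcub g2 g3 (N / f)"
      using f0 by (simp add: wcub_def diff_divide_distrib power_divide) (simp add: eval_nat_numeral)
    also have "N / f = wdup g2 g3 (Y (z / 2))" by (simp add: wdup_def N_def f_def y_def)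
    finally show ?case using d DERIV_imp_deriv[OF d] unfolding field_differentiable_def by auto
  qed
  define X where "X = (\<lambda>z. wdup g2 g3 (Y (z / 2)))"
  have "\<forall>\<^sub>F z in at 0. X field_differentiable at z"
    using ev unfolding X_def by eventually_elim (rule conjunct1)
  then obtain r where r: "r > 0" "\<forall>z\<in>UNIV. z \<noteq> 0 \<and> dist z 0 < r \<longrightarrow> X field_differentiable at z"
    unfolding eventually_at by (elim exE conjE)
  have "X holomorphic_on ball 0 r - {0}"
    unfolding holomorphic_on_def
  proof
    fix z :: complex assume "z \<in> ball 0 r - {0}"
    then have "X field_differentiable at z" using r(2) by simp
    then show "X field_differentiable at z within ball 0 r - {0}" by (rule field_differentiable_at_within)
  qed
  then have "X analytic_on ball 0 r - {0}" by (subst analytic_on_open) auto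
  then have iX: "isolated_singularity_at X 0"
    unfolding isolated_singularity_at_def using r(1) by blast
  have dX: "\<forall>\<^sub>F z in at 0. (deriv X z)^2 = wcub g2 g3 (X z)"
    using ev unfolding X_def by eventually_elim (rule conjunct2)
  have LX: "((\<lambda>z. z^2 * X z) \<longlongrightarrow> 1) (at 0)" using L by (simp only: X_def)
  have "wgerm g2 g3 X" unfolding wgerm_def by (intro conjI iX LX dX)
  then show ?thesis by (simp only: X_def)
qed

text \<open>If P is meromorphic on a disc, then P(z/2) is so on the disc of twice the radius, and
  \<open>wdup\<close> is rational. \<open>remove_sings\<close> corrects the values where P(z/2) has
  a pole or hits a root of the cubic.\<close>

lemma wgerm_extension:
  assumes r: "r > 0" and Y: "Y meromorphic_on ball 0 r" "wgerm g2 g3 Y"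
  shows "\<exists>P. P nicely_meromorphic_on ball 0 (2 ^ n * r) \<and> wgerm g2 g3 P"
proof (induction n)
  case 0
  have "wgerm g2 g3 (remove_sings Y)"
    by (rule wgerm_cong[OF Y(2) eventually_remove_sings_eq_at]) (use Y(2) in \<open>simp add: wgerm_def\<close>)
  then show ?case using remove_sings_nicely_meromorphic[OF Y(1)] by (intro exI[of _ "remove_sings Y"]) simp
next
  case (Suc n)
  then obtain P where P: "P nicely_meromorphic_on ball 0 (2 ^ n * r)" "wgerm g2 g3 P" by blast
  let ?Q = "\<lambda>z. wdup g2 g3 (P (z / 2))"
  have "P meromorphic_on ball 0 (2 ^ n * r)" using P(1) by (simp add: nicely_meromorphic_on_def)
  then have "(\<lambda>z. P (z / 2)) meromorphic_on ball 0 (2 ^ Suc n * r)"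
    by (rule meromorphic_on_compose) (auto intro!: analytic_intros simp: norm_divide)
  then have "?Q meromorphic_on ball 0 (2 ^ Suc n * r)"
    unfolding wdup_def wcub_def by (intro meromorphic_intros)
  then have "remove_sings ?Q nicely_meromorphic_on ball 0 (2 ^ Suc n * r)"
    by (rule remove_sings_nicely_meromorphic)
  moreover have dup: "wgerm g2 g3 ?Q" by (rule wgerm_duplication[OF P(2)])
  moreover have "wgerm g2 g3 (remove_sings ?Q)"
    by (rule wgerm_cong[OF dup eventually_remove_sings_eq_at]) (use dup in \<open>simp add: wgerm_def\<close>)
  ultimately show ?case by blast
qed

lemma wgerm_global:
  obtains P where "P nicely_meromorphic_on UNIV" "wgerm g2 g3 P"
proof -
  obtain Y r where r: "r > 0" and Y: "Y meromorphic_on ball 0 r" "wgerm g2 g3 Y"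
    by (rule wgerm_exists)
  let ?B = "\<lambda>n::nat. ball (0::complex) (2 ^ n * r)"
  have "\<forall>n. \<exists>P. P nicely_meromorphic_on ?B n \<and> wgerm g2 g3 P"
    using wgerm_extension[OF r Y] by blast
  then obtain Q where Q: "\<And>n. Q n nicely_meromorphic_on ?B n" "\<And>n. wgerm g2 g3 (Q n)"
    by metis
  have agree: "Q m z = Q n z" if "m \<le> n" "z \<in> ?B m" for m n z
  proof (rule nicely_meromorphic_identity[OF Q(1)])
    have "(2::real) ^ m \<le> 2 ^ n" using that(1) by simp
    then have "?B m \<subseteq> ?B n" using r by (intro subset_ball mult_right_mono) auto
    then show "Q n nicely_meromorphic_on ?B m" by (rule nicely_meromorphic_on_subset[OF Q(1)])
    show "\<forall>\<^sub>F w in at 0. Q m w = Q n w" by (rule wgerm_unique[OF Q(2) Q(2)])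
  qed (use that r in auto)
  have ex: "\<exists>n. z \<in> ?B n" for z
  proof -
    obtain n where "cmod z / r < 2 ^ n" using real_arch_pow[of 2] by auto
    then show ?thesis using r by (auto simp: field_simps)
  qed
  \<comment> \<open>By \<open>agree\<close>, every disc containing z gives the same value; the least
    index merely fixes a choice.\<close>
  define P where "P = (\<lambda>z. Q (LEAST n. z \<in> ?B n) z)"
  have PQ: "P z = Q n z" if "z \<in> ?B n" for n z
    unfolding P_def by (rule agree) (use that in \<open>auto intro: Least_le LeastI\<close>)
  have "P nicely_meromorphic_on \<Union>(range ?B)"
  proof (rule nicely_meromorphic_on_Union)
    fix A assume "A \<in> range ?B"
    then obtain n where "A = ?B n" by auto
    then show "P nicely_meromorphic_on A"
      using nicely_meromorphic_on_open_subset_cong[OF open_ball PQ Q(1)] by simp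
  qed
  moreover have "\<Union>(range ?B) = UNIV" using ex by auto
  moreover have "wgerm g2 g3 P"
  proof (rule wgerm_cong[OF Q(2)[of 0]])
    have "\<forall>\<^sub>F z in at 0. z \<in> ?B 0" using r by (intro eventually_at_in_open') auto
    then show "\<forall>\<^sub>F z in at 0. P z = Q 0 z" by eventually_elim (rule PQ)
  qed
  ultimately show ?thesis using that by simp
qed

section \<open>Permanence of differential relations; existence and uniqueness of
  \<open>wp\<close>\<close>

lemma meromorphic_eq_zero_if_eventually:
  assumes "d meromorphic_on UNIV" "\<forall>\<^sub>F u in at 0. d u = 0" "d analytic_on {z}"
  shows "d z = 0"
proof -
  have "\<forall>\<^sub>F u in at 0. remove_sings d u = d u"
    by (intro eventually_remove_sings_eq_at meromorphic_on_isolated_singularity[OF meromorphic_on_subset[OF assms(1)]]) simp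
  with assms(2) have "\<forall>\<^sub>F u in at 0. remove_sings d u = 0" by eventually_elim simp
  then have "\<exists>\<^sub>F u in at 0. remove_sings d u = 0" by (intro eventually_frequently) auto
  then have "remove_sings d z = 0"
    by (rule frequently_eq_meromorphic_imp_constant[OF _ remove_sings_nicely_meromorphic[OF assms(1)]]) auto
  then show ?thesis using assms(3) by simp
qed

lemma wgerm_ode:
  assumes P: "P nicely_meromorphic_on UNIV" "wgerm g2 g3 P" and z: "\<not> is_pole P z"
  shows "(deriv P z)^2 = wcub g2 g3 (P z)"
proof -
  let ?d = "\<lambda>z. (deriv P z)^2 - wcub g2 g3 (P z)"
  have "P meromorphic_on UNIV" using P(1) by (simp add: nicely_meromorphic_on_def)
  then have "?d meromorphic_on UNIV"
    unfolding wcub_def by (intro meromorphic_intros)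
  moreover have "\<forall>\<^sub>F u in at 0. ?d u = 0" using P(2) by (simp add: wgerm_def)
  moreover have "P analytic_on {z}" using P(1) z by (intro nicely_meromorphic_on_imp_analytic_at) auto
  then have "?d analytic_on {z}" unfolding wcub_def by (intro analytic_intros)
  ultimately have "?d z = 0" by (rule meromorphic_eq_zero_if_eventually)
  then show ?thesis by simp
qed

text \<open>Reduces the definition to the leading behaviour at 0: the exact principal part is
  \<open>wgerm_principal_part\<close>, and the equation spreads from a neighbourhood of 0 to all
  regular points by permanence.\<close>

lemma is_weierstrass_p_iff:
  "is_weierstrass_p g2 g3 P \<longleftrightarrow> P nicely_meromorphic_on UNIV \<and> wgerm g2 g3 P"
proof
  assume P: "is_weierstrass_p g2 g3 P"
  then have nice: "P nicely_meromorphic_on UNIV" and lim: "((\<lambda>z. P z - 1 / z^2) \<longlongrightarrow> 0) (at 0)"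
    and ode: "\<And>z. \<not> is_pole P z \<Longrightarrow> (deriv P z)^2 = wcub g2 g3 (P z)"
    by (auto simp: is_weierstrass_p_def wcub_def)
  have mero: "P meromorphic_on UNIV" using nice by (simp add: nicely_meromorphic_on_def)
  have iso: "isolated_singularity_at P 0"
    by (rule meromorphic_on_isolated_singularity[OF meromorphic_on_subset[OF mero]]) simp
  have "((\<lambda>z. z^2 * (P z - 1 / z^2) + 1) \<longlongrightarrow> 0^2 * 0 + 1) (at 0)" by (intro tendsto_intros lim)
  then have "((\<lambda>z. z^2 * P z) \<longlongrightarrow> 0^2 * 0 + 1) (at 0)"
    by (rule Lim_transform_eventually) (auto simp: eventually_at_filter field_simps)
  moreover have "\<forall>\<^sub>F z in at 0. (deriv P z)^2 = wcub g2 g3 (P z)"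
  proof -
    obtain r where r: "r > 0" "P analytic_on ball 0 r - {0}" using iso by (auto simp: isolated_singularity_at_def)
    have "\<forall>\<^sub>F z in at 0. z \<in> ball 0 r - {0}" using r(1) by (intro eventually_at_in_open) auto
    then show ?thesis
    proof eventually_elim
      case (elim z)
      then have "P analytic_on {z}" using r(2) by (auto intro: analytic_on_subset)
      then show ?case by (intro ode) (auto simp: analytic_at_imp_no_pole)
    qed
  qed
  ultimately show "P nicely_meromorphic_on UNIV \<and> wgerm g2 g3 P"
    using nice iso by (simp add: wgerm_def)
next
  assume P: "P nicely_meromorphic_on UNIV \<and> wgerm g2 g3 P"
  then show "is_weierstrass_p g2 g3 P"
    using wgerm_principal_part wgerm_ode unfolding is_weierstrass_p_def wcub_def by blast
qed

lemma wp_eqI: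
  assumes "is_weierstrass_p g2 g3 P"
  shows "wp g2 g3 = P"
  unfolding wp_def
proof (rule the_equality)
  show "is_weierstrass_p g2 g3 P" by (rule assms)
  fix Q assume "is_weierstrass_p g2 g3 Q"
  then have "Q z = P z" for z
    using assms unfolding is_weierstrass_p_iff
    by (intro nicely_meromorphic_identity[of Q UNIV P 0] wgerm_unique) auto
  then show "Q = P" by blast
qed

lemma is_weierstrass_p_wp: "is_weierstrass_p g2 g3 (wp g2 g3)"
proof -
  obtain P where "P nicely_meromorphic_on UNIV" "wgerm g2 g3 P" by (rule wgerm_global)
  then have "is_weierstrass_p g2 g3 P" by (simp add: is_weierstrass_p_iff)
  then show ?thesis using wp_eqI by simp
qed

subsection \<open>Parity, second derivative and values\<close>

lemma wgerm_eventually_analytic: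
  assumes "wgerm g2 g3 Y"
  shows "\<forall>\<^sub>F z in at 0. Y analytic_on {z}"
proof -
  obtain r where r: "r > 0" "Y analytic_on ball 0 r - {0}"
    using assms by (auto simp: wgerm_def isolated_singularity_at_def)
  have "\<forall>\<^sub>F z in at 0. z \<in> ball 0 r - {0}" using r(1) by (intro eventually_at_in_open) auto
  then show ?thesis by eventually_elim (use r(2) in \<open>auto intro: analytic_on_subset\<close>)
qed

text \<open>z^6 wcub(Y) tends to 4. Through Y'^2 = wcub(Y) this makes Y' nonzero near the pole, so
  that it can be cancelled.\<close>

lemma wgerm_cubic_nonzero:
  assumes "wgerm g2 g3 Y"
  shows "\<forall>\<^sub>F z in at 0. wcub g2 g3 (Y z) \<noteq> 0"
proof -
  have lim: "((\<lambda>z. z^2 * Y z) \<longlongrightarrow> 1) (at 0)" using assms by (simp add: wgerm_def)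
  have "((\<lambda>z. 4 * (z^2 * Y z)^3 - g2 * z^4 * (z^2 * Y z) - g3 * z^6) \<longlongrightarrow> 4 * 1^3 - g2 * 0^4 * 1 - g3 * 0^6) (at 0)"
    by (intro tendsto_intros lim)
  then have "\<forall>\<^sub>F z in at 0. 4 * (z^2 * Y z)^3 - g2 * z^4 * (z^2 * Y z) - g3 * z^6 \<noteq> 0"
    by (rule tendsto_imp_eventually_ne) simp
  then show ?thesis
  proof eventually_elim
    case (elim z)
    have "4 * (z^2 * Y z)^3 - g2 * z^4 * (z^2 * Y z) - g3 * z^6 = z^6 * wcub g2 g3 (Y z)"
      by (simp add: wcub_def algebra_simps eval_nat_numeral)
    then show ?case using elim by auto
  qed
qed

text \<open>Differentiating P'^2 = wcub(P) gives 2 P' P'' = (12 P^2 - g2) P'. Near 0 the factor P'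
  is nonzero and cancels; permanence then carries the result to every regular point, including the
  zeros of P'.\<close>

lemma wgerm_second_derivative:
  assumes P: "P nicely_meromorphic_on UNIV" "wgerm g2 g3 P" and z: "\<not> is_pole P z"
  shows "deriv (deriv P) z = 6 * (P z)^2 - g2 / 2"
proof -
  let ?d = "\<lambda>z. deriv (deriv P) z - (6 * (P z)^2 - g2 / 2)"
  have "P meromorphic_on UNIV" using P(1) by (simp add: nicely_meromorphic_on_def)
  then have md: "?d meromorphic_on UNIV" by (intro meromorphic_intros)
  have an: "P analytic_on {z}" if "\<not> is_pole P z" for z
    using P(1) that by (intro nicely_meromorphic_on_imp_analytic_at) auto
  have "\<forall>\<^sub>F z in at 0. ?d z = 0"
    using wgerm_cubic_nonzero[OF P(2)] wgerm_eventually_analytic[OF P(2)]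
  proof eventually_elim
    case (elim z)
    obtain A where A: "open A" "z \<in> A" "P holomorphic_on A" using elim(2) by (auto simp: analytic_at)
    have np: "\<not> is_pole P u" if "u \<in> A" for u using A that by (intro not_is_pole_holomorphic)
    have "deriv P analytic_on {z}" using elim(2) by (intro analytic_deriv)
    then have d2: "(deriv P has_field_derivative deriv (deriv P) z) (at z)" by (rule analytic_derivI)
    have d1: "(P has_field_derivative deriv P z) (at z)" using elim(2) by (rule analytic_derivI)
    have "((\<lambda>u. (deriv P u)^2) has_field_derivative 2 * deriv P z * deriv (deriv P) z) (at z)"
      using DERIV_mult[OF d2 d2] by (simp add: power2_eq_square mult_ac flip: mult_2)
    moreover have "((\<lambda>u. (deriv P u)^2) has_field_derivative (12 * (P z)^2 - g2) * deriv P z) (at z)"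
    proof (rule has_field_derivative_transform_within_open[OF _ A(1,2)])
      have "(wcub g2 g3 has_field_derivative 12 * y^2 - g2) (at y)" for y
        unfolding wcub_def[abs_def] by (auto intro!: derivative_eq_intros)
      from DERIV_chain2[OF this d1]
      show "((\<lambda>u. wcub g2 g3 (P u)) has_field_derivative (12 * (P z)^2 - g2) * deriv P z) (at z)" .
      show "wcub g2 g3 (P u) = (deriv P u)^2" if "u \<in> A" for u
        using wgerm_ode[OF P np[OF that]] by simp
    qed
    ultimately have "2 * deriv P z * deriv (deriv P) z = (12 * (P z)^2 - g2) * deriv P z"
      by (rule DERIV_unique)
    then have "deriv P z * (2 * deriv (deriv P) z) = deriv P z * (12 * (P z)^2 - g2)"
      by (simp only: ac_simps)
    moreover have "deriv P z \<noteq> 0" using wgerm_ode[OF P np[OF A(2)]] elim(1) by auto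
    ultimately have "2 * deriv (deriv P) z = 12 * (P z)^2 - g2" by simp
    then show ?case by (simp add: field_simps)
  qed
  moreover have "?d analytic_on {z}" using an[OF z] by (intro analytic_intros)
  ultimately have "?d z = 0" by (rule meromorphic_eq_zero_if_eventually[OF md])
  then show ?thesis by simp
qed

text \<open>The conditions on a germ involve only z^2 and Y'^2, so they survive z -> -z; together
  with uniqueness this makes the Weierstrass function even.\<close>

lemma wgerm_reflect:
  assumes "wgerm g2 g3 Y"
  shows "wgerm g2 g3 (\<lambda>z. Y (- z))"
proof -
  have neg: "filterlim (\<lambda>z::complex. - z) (at 0) (at 0)"
    by (intro filterlim_atI) (auto intro!: tendsto_eq_intros simp: eventually_at_filter)
  have lim: "((\<lambda>z. z^2 * Y z) \<longlongrightarrow> 1) (at 0)" using assms by (simp add: wgerm_def)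
  have L: "((\<lambda>z. z^2 * Y (- z)) \<longlongrightarrow> 1) (at 0)" using filterlim_compose[OF lim neg] by simp
  obtain r where r: "r > 0" "Y analytic_on ball 0 r - {0}"
    using assms by (auto simp: wgerm_def isolated_singularity_at_def)
  have "(\<lambda>z. Y (- z)) analytic_on ball 0 r - {0}"
  proof (rule analytic_on_compose_gen[of uminus _ Y "ball 0 r - {0}", unfolded o_def, OF _ r(2)])
    show "uminus analytic_on ball 0 r - {0::complex}" by (rule analytic_on_neg[OF analytic_on_ident])
  qed simp
  then have I: "isolated_singularity_at (\<lambda>z. Y (- z)) 0"
    unfolding isolated_singularity_at_def using r(1) by blast
  have "\<forall>\<^sub>F z in at 0. Y analytic_on {z} \<and> (deriv Y z)^2 = wcub g2 g3 (Y z)"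
    using assms unfolding wgerm_def by (intro eventually_conj wgerm_eventually_analytic[OF assms]) blast
  from filterlim_iff[THEN iffD1, OF neg, rule_format, OF this]
  have "\<forall>\<^sub>F z in at 0. (deriv (\<lambda>z. Y (- z)) z)^2 = wcub g2 g3 (Y (- z))"
  proof eventually_elim
    case (elim z)
    have "(Y has_field_derivative deriv Y (- z)) (at (- z))" using elim by (intro analytic_derivI) auto
    from DERIV_chain2[where g = uminus and x = z, OF this DERIV_minus[OF DERIV_ident]]
    have "((\<lambda>z. Y (- z)) has_field_derivative - deriv Y (- z)) (at z)" by simp
    then have "deriv (\<lambda>z. Y (- z)) z = - deriv Y (- z)" by (rule DERIV_imp_deriv)
    then show ?case using elim by simp
  qed
  then show ?thesis unfolding wgerm_def by (intro conjI L I)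
qed

lemma wgerm_even:
  assumes P: "P nicely_meromorphic_on UNIV" "wgerm g2 g3 P" and z: "\<not> is_pole P z"
  shows "\<not> is_pole P (- z) \<and> P (- z) = P z \<and> deriv P (- z) = - deriv P z"
proof -
  let ?Q = "\<lambda>z. P (- z)"
  have "P meromorphic_on UNIV" using P(1) by (simp add: nicely_meromorphic_on_def)
  then have mQ: "?Q meromorphic_on UNIV"
    by (rule meromorphic_on_compose) (auto intro!: analytic_intros)
  have "wgerm g2 g3 (remove_sings ?Q)"
    using wgerm_reflect[OF P(2)]
    by (rule wgerm_cong[OF _ eventually_remove_sings_eq_at]) (use wgerm_reflect[OF P(2)] wgerm_def in blast)
  then have PQ: "P u = remove_sings ?Q u" for u
    by (intro nicely_meromorphic_identity[OF P(1) remove_sings_nicely_meromorphic[OF mQ], of 0] wgerm_unique[OF P(2)]) auto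
  have aP: "P analytic_on {z}"
    using P(1) z by (intro nicely_meromorphic_on_imp_analytic_at) auto
  then have aQ: "?Q analytic_on {- z}"
    by (intro analytic_on_compose_gen[of uminus _ P "{z}", unfolded o_def] analytic_on_neg[OF analytic_on_ident]) auto
  have ev: "\<forall>\<^sub>F u in nhds (- z). P u = ?Q u"
    using eventually_remove_sings_eq_nhds[OF aQ] by eventually_elim (rule trans[OF PQ])
  then have "deriv P (- z) = deriv ?Q (- z)" by (intro deriv_cong_ev) auto
  moreover have "deriv ?Q (- z) = - deriv P z"
  proof -
    have "(P has_field_derivative deriv P z) (at (- (- z)))" using aP by (simp add: analytic_derivI)
    from DERIV_chain2[where g = uminus and x = "- z", OF this DERIV_minus[OF DERIV_ident]]
    have "(?Q has_field_derivative - deriv P z) (at (- z))" by simp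
    then show ?thesis by (rule DERIV_imp_deriv)
  qed
  moreover have "P analytic_on {- z}" using analytic_at_cong[OF ev refl] aQ by simp
  ultimately show ?thesis using eventually_nhds_x_imp_x[OF ev] analytic_at_imp_no_pole by auto
qed

section \<open>Values attained by the Weierstrass function\<close>

lemma wgerm_attains_up_to_sign:
  assumes P: "P nicely_meromorphic_on UNIV" "wgerm g2 g3 P"
    and v: "v^2 = wcub g2 g3 w" "v \<noteq> 0"
  shows "\<exists>a. \<not> is_pole P a \<and> P a = w"
proof (rule ccontr)
  assume "\<nexists>a. \<not> is_pole P a \<and> P a = w"
  then have omit: "P a \<noteq> w" if "\<not> is_pole P a" for a using that by blast
  have an: "P analytic_on {z}" if "\<not> is_pole P z" for z
    using P(1) that by (intro nicely_meromorphic_on_imp_analytic_at) auto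
  have mP: "P meromorphic_on UNIV" using P(1) by (simp add: nicely_meromorphic_on_def)
  have evnp: "\<forall>\<^sub>F u in at z. \<not> is_pole P u" for z
  proof -
    have "isolated_singularity_at P z"
      by (rule meromorphic_on_isolated_singularity[OF meromorphic_on_subset[OF mP]]) simp
    then obtain r where r: "r > 0" "P analytic_on ball z r - {z}" by (auto simp: isolated_singularity_at_def)
    have "\<forall>\<^sub>F u in at z. u \<in> ball z r - {z}" using r(1) by (intro eventually_at_in_open) auto
    then show ?thesis
    proof eventually_elim
      case (elim u)
      then have "P analytic_on {u}" using r(2) by (auto intro: analytic_on_subset)
      then show ?case by (rule analytic_at_imp_no_pole)
    qed
  qed
  have hF: "wcub g2 g3 holomorphic_on UNIV"
    unfolding wcub_def[abs_def] by (intro holomorphic_intros)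
  obtain q r where q: "r > 0" "q holomorphic_on ball 0 r" "q 0 = w" "deriv q 0 = v"
    "\<And>z. z \<in> ball 0 r \<Longrightarrow> deriv q z \<noteq> 0 \<and> (deriv q z)^2 = wcub g2 g3 (q z)"
    by (rule flow_exists[OF hF v]) blast
  \<comment> \<open>As q'(0) = v is nonzero, \<open>q\<close> is open near 0, and every value within
    \<open>e\<close> of \<open>w\<close> is attained by this one local solution. The radius
    \<open>e\<close> does not depend on the point where P comes close to \<open>w\<close>.\<close>
  have c0: "(0::complex) \<in> ball 0 r" and dq0: "deriv q 0 \<noteq> 0" using q(1,4) v(2) by auto
  obtain r' where r': "r' > 0" "ball (0::complex) r' \<subseteq> ball 0 r" "open (q ` ball 0 r')"
    by (rule has_complex_derivative_locally_invertible[OF q(2) c0 open_ball dq0]) blast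
  have "w \<in> q ` ball 0 r'" using q(3) r'(1) by (intro image_eqI[of _ _ 0]) auto
  then obtain e where e: "e > 0" "ball w e \<subseteq> q ` ball 0 r'"
    using r'(3) open_contains_ball by blast
  have far: "e \<le> cmod (P z0 - w)" if np: "\<not> is_pole P z0" for z0
  proof (rule ccontr)
    assume "\<not> e \<le> cmod (P z0 - w)"
    then have "P z0 \<in> ball w e" by (simp add: dist_norm norm_minus_commute)
    then have "P z0 \<in> q ` ball 0 r'" by (rule subsetD[OF e(2)])
    then obtain \<zeta> where "\<zeta> \<in> ball 0 r'" "P z0 = q \<zeta>" by (rule imageE)
    then have \<zeta>: "\<zeta> \<in> ball 0 r" "P z0 = q \<zeta>" using r'(2) by blast+
    have "(deriv P z0)^2 = (deriv q \<zeta>)^2"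
      using wgerm_ode[OF P np] q(5)[OF \<zeta>(1)] \<zeta>(2) by simp
    then have "deriv P z0 = deriv q \<zeta> \<or> deriv P z0 = - deriv q \<zeta>" by (simp add: power2_eq_iff)
    then have "deriv P z0 = 1 * deriv q \<zeta> \<or> deriv P z0 = (- 1) * deriv q \<zeta>" by simp
    then obtain s :: complex where s: "s = 1 \<or> s = - 1" "deriv P z0 = s * deriv q \<zeta>" by blast
    then have s2: "s^2 = 1" and ns: "cmod s = 1" by auto
    \<comment> \<open>The equation is autonomous and invariant under time reversal. \<open>Q\<close>
      is \<open>q\<close> run in the direction \<open>s\<close> and shifted so that it meets P at
      \<open>z0\<close> with the same velocity; at \<open>b\<close> it takes the value
      \<open>w\<close>.\<close>
    define b where "b = z0 - s * \<zeta>"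
    define Q where "Q = (\<lambda>z. q (s * (z - b)))"
    have ss: "s * s = 1" using s2 by (simp add: power2_eq_square)
    have Qd: "(Q has_field_derivative deriv q (s * (z - b)) * s) (at z)" if "z \<in> ball b r" for z
    proof -
      have "s * (z - b) \<in> ball 0 r" using that ns by (simp add: norm_mult dist_norm norm_minus_commute)
      then have "(q has_field_derivative deriv q (s * (z - b))) (at (s * (z - b)))"
        using q(2) by (intro holomorphic_derivI[of _ "ball 0 r"]) auto
      then show ?thesis unfolding Q_def
        by (rule DERIV_chain2[where f = q and g = "\<lambda>z. s * (z - b)" and x = z]) (auto intro!: derivative_eq_intros)
    qed
    have hQ: "Q holomorphic_on ball b r" unfolding holomorphic_on_open[OF open_ball] using Qd by blast
    have "s * (s * \<zeta>) = \<zeta>" using ss by (simp flip: mult.assoc)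
    then have arg0: "s * (z0 - b) = \<zeta>" by (simp add: b_def)
    have z0: "z0 \<in> ball b r" using \<zeta>(1) ns by (simp add: b_def dist_norm norm_mult)
    have aQ: "Q analytic_on {z0}" using hQ z0 by (auto simp: analytic_at intro!: exI[of _ "ball b r"])
    have "\<forall>\<^sub>F z in nhds z0. P z = Q z"
    proof (rule flow_unique[OF hF an[OF np] aQ])
      obtain A where A: "open A" "z0 \<in> A" "P holomorphic_on A" using an[OF np] by (auto simp: analytic_at)
      show "\<forall>\<^sub>F z in nhds z0. (deriv P z)^2 = wcub g2 g3 (P z)"
        using eventually_nhds_in_open[OF A(1,2)]
        by eventually_elim (rule wgerm_ode[OF P not_is_pole_holomorphic[OF A(1) _ A(3)]])
      have "\<forall>\<^sub>F z in nhds z0. z \<in> ball b r" using z0 by (intro eventually_nhds_in_open) auto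
      then show "\<forall>\<^sub>F z in nhds z0. (deriv Q z)^2 = wcub g2 g3 (Q z)"
      proof eventually_elim
        case (elim z)
        have "s * (z - b) \<in> ball 0 r" using elim ns by (simp add: norm_mult dist_norm norm_minus_commute)
        then show ?case using DERIV_imp_deriv[OF Qd[OF elim]] q(5) s2 by (simp add: Q_def power_mult_distrib)
      qed
      show "P z0 = Q z0" using \<zeta>(2) arg0 by (simp add: Q_def)
      show "deriv P z0 = deriv Q z0" using DERIV_imp_deriv[OF Qd[OF z0]] arg0 s(2) by simp
      show "deriv P z0 \<noteq> 0" using s(2) ns q(5)[OF \<zeta>(1)] by auto
    qed
    then have ev: "\<forall>\<^sub>F z in at z0. P z = Q z" by (simp add: eventually_nhds_conv_at)
    \<comment> \<open>Equality near \<open>z0\<close> spreads over the whole disc about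
      \<open>b\<close>, in particular to its centre, where \<open>Q\<close> equals \<open>w\<close>:
      the omitted value is attained after all.\<close>
    have nQ: "Q nicely_meromorphic_on ball b r"
      using hQ by (intro analytic_on_imp_nicely_meromorphic_on) (simp add: analytic_on_open)
    have nP: "P nicely_meromorphic_on ball b r"
      by (rule nicely_meromorphic_on_subset[OF P(1)]) simp
    have PQ: "P z = Q z" if "z \<in> ball b r" for z
      by (rule nicely_meromorphic_identity[OF nP nQ open_ball connected_ball z0 ev that])
    have bb: "b \<in> ball b r" using q(1) by simp
    have "P holomorphic_on ball b r" using hQ PQ by (subst holomorphic_cong[of _ _ P Q]) auto
    then have "\<not> is_pole P b" by (rule not_is_pole_holomorphic[OF open_ball bb])
    moreover have "P b = w" using PQ[OF bb] q(3) by (simp add: Q_def)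
    ultimately show False using omit by blast
  qed
  define G where "G = (\<lambda>z. 1 / (P z - w))"
  have mG: "G meromorphic_on UNIV" unfolding G_def by (intro meromorphic_intros mP)
  have GR: "\<forall>\<^sub>F u in at z. remove_sings G u = G u" for z
    by (intro eventually_remove_sings_eq_at meromorphic_on_isolated_singularity[OF meromorphic_on_subset[OF mG]]) simp
  have bR: "\<forall>\<^sub>F u in at z. cmod (remove_sings G u) \<le> 1 / e" for z
    using GR[of z] evnp[of z]
  proof eventually_elim
    case (elim u)
    have "e \<le> cmod (P u - w)" using elim(2) by (rule far)
    then have "1 / cmod (P u - w) \<le> 1 / e" using e(1) by (intro divide_left_mono mult_pos_pos) auto
    then show ?case using elim(1) by (simp add: G_def norm_divide)
  qed
  have nR: "remove_sings G nicely_meromorphic_on UNIV" by (rule remove_sings_nicely_meromorphic[OF mG])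
  have npR: "\<not> is_pole (remove_sings G) z" for z
  proof
    assume "is_pole (remove_sings G) z"
    then have "\<forall>\<^sub>F u in at z. 1 / e + 1 \<le> cmod (remove_sings G u)"
      unfolding is_pole_def filterlim_at_infinity_conv_norm_at_top filterlim_at_top by blast
    with bR[of z] have "\<forall>\<^sub>F u in at z. False" by eventually_elim simp
    then show False by simp
  qed
  have aR: "remove_sings G analytic_on UNIV"
    using nicely_meromorphic_without_singularities[OF nR] npR by blast
  have "cmod (remove_sings G z) \<le> 1 / e" for z
  proof -
    have "remove_sings G analytic_on {z}" using aR by (rule analytic_on_subset) simp
    then have "remove_sings G \<midarrow>z\<rightarrow> remove_sings G z" using analytic_at_imp_isCont isContD by blast
    then have "((\<lambda>u. cmod (remove_sings G u)) \<longlongrightarrow> cmod (remove_sings G z)) (at z)" by (rule tendsto_norm)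
    then show ?thesis by (rule tendsto_upperbound) (use bR[of z] in auto)
  qed
  then have "bounded (range (remove_sings G))" unfolding bounded_iff by blast
  with analytic_imp_holomorphic[OF aR] have "remove_sings G constant_on UNIV" by (rule Liouville_theorem)
  then obtain c where c: "\<And>z. remove_sings G z = c" by (auto simp: constant_on_def)
  \<comment> \<open>The double pole of P at 0 forces the constant to be 0, whereas 1 / (P - w) is
    nonzero at regular points of P because \<open>w\<close> is omitted.\<close>
  have lim: "((\<lambda>z. z^2 * P z) \<longlongrightarrow> 1) (at 0)" using P(2) by (simp add: wgerm_def)
  have "((\<lambda>z. z^2 / (z^2 * P z - z^2 * w)) \<longlongrightarrow> 0^2 / (1 - 0^2 * w)) (at 0)"
    by (intro tendsto_intros lim) auto
  moreover have "\<forall>\<^sub>F z in at 0. z^2 / (z^2 * P z - z^2 * w) = c"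
    using GR[of 0] eventually_at_in_open[OF open_UNIV UNIV_I, of 0]
  proof eventually_elim
    case (elim z)
    have "z^2 / (z^2 * P z - z^2 * w) = z^2 / (z^2 * (P z - w))" by (simp add: right_diff_distrib)
    also have "\<dots> = c" using elim c[of z] by (simp add: G_def)
    finally show ?case .
  qed
  ultimately have "((\<lambda>z. c) \<longlongrightarrow> 0^2 / (1 - 0^2 * w)) (at (0::complex))"
    by (rule Lim_transform_eventually)
  then have "c = 0" by (simp add: tendsto_const_iff)
  from GR[of 0] evnp[of 0] have "\<forall>\<^sub>F z in at (0::complex). False"
  proof eventually_elim
    case (elim z)
    then show ?case using \<open>c = 0\<close> c[of z] omit[of z] by (simp add: G_def)
  qed
  then show False by simp
qed

text \<open>If the derivative at a preimage of \<open>w\<close> has the wrong sign, evenness makes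
  the opposite point a preimage with the right one.\<close>

lemma wgerm_attains:
  assumes P: "P nicely_meromorphic_on UNIV" "wgerm g2 g3 P"
    and v: "v^2 = wcub g2 g3 w" "v \<noteq> 0"
  obtains a where "\<not> is_pole P a" "P a = w" "deriv P a = v"
proof -
  obtain a where a: "\<not> is_pole P a" "P a = w"
    using wgerm_attains_up_to_sign[OF assms] by blast
  have "(deriv P a)^2 = v^2" using wgerm_ode[OF P a(1)] v(1) a(2) by simp
  then have "deriv P a = v \<or> deriv P a = - v" by (simp add: power2_eq_iff)
  then show ?thesis
    using that[of a] that[of "- a"] wgerm_even[OF P a(1)] a by auto
qed

subsection \<open>Solutions on the real line\<close>

text \<open>Gronwall's argument for E = |d|^2 + |d1|^2. Since |E'| \<le> (1 + L) E, the product of E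
  with exp(-(1 + L) s) is nonincreasing and that with exp((1 + L) s) is nondecreasing, which gives E
  \<le> 0 on both sides of \<open>t0\<close>.\<close>

lemma second_order_zero:
  fixes d d1 d2 :: "real \<Rightarrow> 'a::real_inner"
  assumes e: "\<bar>t - t0\<bar> < e"
    and d: "\<And>s. \<bar>s - t0\<bar> < e \<Longrightarrow> (d has_vector_derivative d1 s) (at s)"
    and d1: "\<And>s. \<bar>s - t0\<bar> < e \<Longrightarrow> (d1 has_vector_derivative d2 s) (at s)"
    and K: "\<And>s. \<bar>s - t0\<bar> < e \<Longrightarrow> norm (d2 s) \<le> K * norm (d s)"
    and i: "d t0 = 0" "d1 t0 = 0"
  shows "d t = 0"
proof -
  define L where "L = max K 0"
  define E where "E = (\<lambda>s. d s \<bullet> d s + d1 s \<bullet> d1 s)"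
  define E' where "E' = (\<lambda>s. 2 * (d s \<bullet> d1 s) + 2 * (d1 s \<bullet> d2 s))"
  have E: "(E has_real_derivative E' s) (at s)" if "\<bar>s - t0\<bar> < e" for s
  proof -
    note bounded_bilinear.has_vector_derivative[OF bounded_bilinear_inner]
    from has_vector_derivative_add[OF this[OF d[OF that] d[OF that]] this[OF d1[OF that] d1[OF that]]]
    show ?thesis
      unfolding E_def E'_def has_real_derivative_iff_has_vector_derivative
      by (rule has_vector_derivative_eq_rhs) (simp add: inner_commute)
  qed
  have E0: "E t0 = 0" using i by (simp add: E_def)
  have bd: "\<bar>E' s\<bar> \<le> (1 + L) * E s" if "\<bar>s - t0\<bar> < e" for s
  proof -
    have "\<bar>d s \<bullet> d1 s\<bar> \<le> norm (d s) * norm (d1 s)" by (rule Cauchy_Schwarz_ineq2)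
    moreover have "\<bar>d1 s \<bullet> d2 s\<bar> \<le> norm (d1 s) * norm (d2 s)" by (rule Cauchy_Schwarz_ineq2)
    moreover have "norm (d1 s) * norm (d2 s) \<le> norm (d1 s) * (L * norm (d s))"
      using K[OF that] by (intro mult_left_mono order_trans[OF K[OF that]] mult_right_mono) (auto simp: L_def)
    ultimately have "\<bar>E' s\<bar> \<le> (1 + L) * (2 * norm (d s) * norm (d1 s))"
      unfolding E'_def by (simp add: algebra_simps)
    also have "\<dots> \<le> (1 + L) * E s"
    proof (rule mult_left_mono)
      show "2 * norm (d s) * norm (d1 s) \<le> E s"
        using sum_squares_bound[of "norm (d s)" "norm (d1 s)"] by (simp add: E_def power2_norm_eq_inner)
    qed (simp add: L_def)
    finally show ?thesis .
  qed
  have "E t \<le> 0"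
  proof (cases "t0 \<le> t")
    case True
    have "E t * exp (- (1 + L) * t) \<le> E t0 * exp (- (1 + L) * t0)"
    proof (rule DERIV_nonpos_imp_nonincreasing[OF True])
      fix s assume "t0 \<le> s" "s \<le> t"
      then have s: "\<bar>s - t0\<bar> < e" using e by auto
      have "((\<lambda>s. E s * exp (- (1 + L) * s)) has_real_derivative (E' s - (1 + L) * E s) * exp (- (1 + L) * s)) (at s)"
        by (auto intro!: derivative_eq_intros E[OF s] simp: algebra_simps)
      moreover have "(E' s - (1 + L) * E s) * exp (- (1 + L) * s) \<le> 0"
        using bd[OF s] by (intro mult_nonpos_nonneg) auto
      ultimately show "\<exists>y. ((\<lambda>s. E s * exp (- (1 + L) * s)) has_real_derivative y) (at s) \<and> y \<le> 0" by blast
    qed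
    then show ?thesis using E0 by (simp add: mult_le_0_iff)
  next
    case False
    then have le: "t \<le> t0" by simp
    have "E t * exp ((1 + L) * t) \<le> E t0 * exp ((1 + L) * t0)"
    proof (rule DERIV_nonneg_imp_nondecreasing[OF le])
      fix s assume "t \<le> s" "s \<le> t0"
      then have s: "\<bar>s - t0\<bar> < e" using e by auto
      have "((\<lambda>s. E s * exp ((1 + L) * s)) has_real_derivative (E' s + (1 + L) * E s) * exp ((1 + L) * s)) (at s)"
        by (auto intro!: derivative_eq_intros E[OF s] simp: algebra_simps)
      moreover have "(E' s + (1 + L) * E s) * exp ((1 + L) * s) \<ge> 0"
        using bd[OF s] by (intro mult_nonneg_nonneg) auto
      ultimately show "\<exists>y. ((\<lambda>s. E s * exp ((1 + L) * s)) has_real_derivative y) (at s) \<and> 0 \<le> y" by blast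
    qed
    then show ?thesis using E0 by (simp add: mult_le_0_iff)
  qed
  moreover have "d t \<bullet> d t \<le> E t" by (simp add: E_def)
  ultimately have "d t \<bullet> d t = 0" using inner_ge_zero[of "d t"] by linarith
  then show ?thesis by simp
qed

lemma analytic_has_vector_derivative_real_line:
  assumes "f analytic_on {a + of_real t}"
  shows "((\<lambda>s. f (a + of_real s)) has_vector_derivative deriv f (a + of_real t)) (at t)"
proof -
  have "((\<lambda>s::real. a + of_real s) has_vector_derivative 1) (at t)"
    by (auto intro!: derivative_eq_intros)
  from field_vector_diff_chain_at[OF this analytic_derivI[OF assms]]
  show ?thesis by (simp add: o_def)
qed

text \<open>The set of times at which P and P' agree with \<open>p\<close> and \<open>p1\<close> is
  open by uniqueness for the second-order equation, closed because \<open>p\<close> is finite and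
  continuous, and contains \<open>t0\<close>.\<close>

lemma wgerm_real_solution:
  fixes p p1 :: "real \<Rightarrow> complex"
  assumes P: "P nicely_meromorphic_on UNIV" "wgerm g2 g3 P"
    and p: "\<And>t. (p has_vector_derivative p1 t) (at t)"
    and p1: "\<And>t. (p1 has_vector_derivative 6 * (p t)^2 - g2 / 2) (at t)"
    and i: "\<not> is_pole P (a + of_real t0)" "P (a + of_real t0) = p t0" "deriv P (a + of_real t0) = p1 t0"
  shows "P (a + of_real t) = p t"
proof -
  define z where "z = (\<lambda>t::real. a + of_real t)"
  have an: "P analytic_on {u}" if "\<not> is_pole P u" for u
    using P(1) that by (intro nicely_meromorphic_on_imp_analytic_at) auto
  have cp: "(p \<longlongrightarrow> p t) (at t)" "(p1 \<longlongrightarrow> p1 t) (at t)" for t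
    using has_vector_derivative_continuous[OF p] has_vector_derivative_continuous[OF p1]
    by (auto simp: isCont_def)
  have cz: "filterlim z (at (z t)) (at t)" for t
  proof (rule filterlim_atI)
    show "(z \<longlongrightarrow> z t) (at t)" unfolding z_def by (intro tendsto_intros)
    show "\<forall>\<^sub>F s in at t. z s \<noteq> z t" by (auto simp: z_def eventually_at_filter)
  qed
  define S where "S = {t. \<not> is_pole P (z t) \<and> P (z t) = p t \<and> deriv P (z t) = p1 t}"
  have "open S"
    unfolding open_contains_ball
  proof
    fix s assume "s \<in> S"
    then have s: "\<not> is_pole P (z s)" "P (z s) = p s" "deriv P (z s) = p1 s" by (auto simp: S_def)
    obtain r where r: "r > 0" "P holomorphic_on ball (z s) r" using an[OF s(1)] by (auto simp: analytic_on_def)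
    have aP: "P analytic_on {z u}" if "\<bar>u - s\<bar> < r" for u
    proof -
      have "z u \<in> ball (z s) r" using that by (simp add: z_def dist_norm norm_minus_commute flip: of_real_diff)
      then show ?thesis using r(2) by (auto simp: analytic_at intro!: exI[of _ "ball (z s) r"])
    qed
    have "((\<lambda>u. P (z u)) \<longlongrightarrow> P (z s)) (at s)"
      using analytic_at_imp_isCont[OF aP[of s]] r(1) cz filterlim_compose unfolding isCont_def by fastforce
    \<comment> \<open>In (P - p)'' = 6 P^2 - 6 p^2 = 6 (P + p)(P - p) the factor 6 (P + p) acts as a
      Lipschitz constant; near \<open>s\<close> its modulus exceeds that at \<open>s\<close> by less
      than 1.\<close>
    then have "((\<lambda>u. cmod (6 * (P (z u) + p u))) \<longlongrightarrow> cmod (6 * (P (z s) + p s))) (at s)"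
      by (intro tendsto_intros cp)
    then have "\<forall>\<^sub>F u in at s. cmod (6 * (P (z u) + p u)) < cmod (6 * (P (z s) + p s)) + 1"
      by (rule order_tendstoD) simp
    then obtain r2 where r2: "r2 > 0" "\<And>u. u \<noteq> s \<Longrightarrow> \<bar>u - s\<bar> < r2 \<Longrightarrow> cmod (6 * (P (z u) + p u)) < cmod (6 * (P (z s) + p s)) + 1"
      unfolding eventually_at by (auto simp: dist_real_def)
    define K where "K = cmod (6 * (P (z s) + p s)) + 1"
    define e where "e = min r r2"
    have dP: "((\<lambda>u. P (z u) - p u) has_vector_derivative deriv P (z u) - p1 u) (at u)" if "\<bar>u - s\<bar> < e" for u
      using aP[of u] that unfolding z_def e_def
      by (intro has_vector_derivative_diff p analytic_has_vector_derivative_real_line) auto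
    have dP1: "((\<lambda>u. deriv P (z u) - p1 u) has_vector_derivative 6 * (P (z u) + p u) * (P (z u) - p u)) (at u)" if u: "\<bar>u - s\<bar> < e" for u
    proof -
      have a: "P analytic_on {z u}" using aP[of u] u by (simp add: e_def)
      have "deriv P analytic_on {a + of_real u}" using a unfolding z_def by (rule analytic_deriv)
      from has_vector_derivative_diff[OF analytic_has_vector_derivative_real_line[OF this] p1[of u]]
      have "((\<lambda>u. deriv P (z u) - p1 u) has_vector_derivative deriv (deriv P) (z u) - (6 * (p u)^2 - g2 / 2)) (at u)"
        unfolding z_def .
      also have "deriv (deriv P) (z u) - (6 * (p u)^2 - g2 / 2) = 6 * (P (z u) + p u) * (P (z u) - p u)"
        using wgerm_second_derivative[OF P analytic_at_imp_no_pole[OF a]] by (simp add: algebra_simps power2_eq_square)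
      finally show ?thesis .
    qed
    have z0: "P (z u) - p u = 0" if u: "\<bar>u - s\<bar> < e" for u
    proof (rule second_order_zero[OF u dP dP1])
      fix v assume v: "\<bar>v - s\<bar> < e"
      have "cmod (6 * (P (z v) + p v)) \<le> K"
        using r2(2)[of v] v by (cases "v = s") (auto simp: K_def e_def)
      then show "cmod (6 * (P (z v) + p v) * (P (z v) - p v)) \<le> K * cmod (P (z v) - p v)"
        by (subst norm_mult) (rule mult_right_mono, auto)
    qed (use s in auto)
    have z1: "deriv P (z u) = p1 u" if u: "\<bar>u - s\<bar> < e" for u
    proof -
      have "((\<lambda>u. P (z u) - p u) has_vector_derivative 0) (at u)"
      proof (rule has_vector_derivative_transform_within_open[where S = "ball s e" and f = "\<lambda>_. 0"])
        show "u \<in> ball s e" using u by (simp add: dist_real_def abs_minus_commute)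
        show "\<And>v. v \<in> ball s e \<Longrightarrow> 0 = P (z v) - p v" using z0 by (simp add: dist_real_def abs_minus_commute)
      qed auto
      from vector_derivative_unique_at[OF this dP[OF u]] show ?thesis by simp
    qed
    have "ball s e \<subseteq> S"
    proof
      fix u assume "u \<in> ball s e"
      then have u: "\<bar>u - s\<bar> < e" by (simp add: dist_real_def abs_minus_commute)
      then have "\<not> is_pole P (z u)" using aP[of u] analytic_at_imp_no_pole by (auto simp: e_def)
      then show "u \<in> S" using z0[OF u] z1[OF u] by (simp add: S_def)
    qed
    then show "\<exists>e>0. ball s e \<subseteq> S" using r(1) r2(1) by (intro exI[of _ e]) (auto simp: e_def)
  qed
  moreover have "closed S"
  proof -
    have "\<forall>\<^sub>F u in at s. u \<notin> S" if "s \<notin> S" for s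
    proof (cases "is_pole P (z s)")
      case True
      \<comment> \<open>Near a pole |P| is at least |p(s)| + 1 while |p| stays below this bound, so
        agreement cannot accumulate there.\<close>
      then have "\<forall>\<^sub>F w in at (z s). cmod (p s) + 1 \<le> cmod (P w)"
        unfolding is_pole_def filterlim_at_infinity_conv_norm_at_top filterlim_at_top by blast
      from filterlim_iff[THEN iffD1, OF cz, rule_format, OF this]
      have "\<forall>\<^sub>F u in at s. cmod (p s) + 1 \<le> cmod (P (z u))" .
      moreover have "\<forall>\<^sub>F u in at s. cmod (p u) < cmod (p s) + 1"
        by (rule order_tendstoD(2)[OF tendsto_norm[OF cp(1)]]) simp
      ultimately show ?thesis by eventually_elim (auto simp: S_def)
    next
      case False
      have "((\<lambda>u. P (z u)) \<longlongrightarrow> P (z s)) (at s)"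
        using filterlim_compose[OF analytic_at_imp_isCont[OF an[OF False], unfolded isCont_def] cz] .
      then have l1: "((\<lambda>u. P (z u) - p u) \<longlongrightarrow> P (z s) - p s) (at s)" by (intro tendsto_diff cp)
      have "((\<lambda>u. deriv P (z u)) \<longlongrightarrow> deriv P (z s)) (at s)"
        using filterlim_compose[OF analytic_at_imp_isCont[OF analytic_deriv[OF an[OF False]], unfolded isCont_def] cz] .
      then have l2: "((\<lambda>u. deriv P (z u) - p1 u) \<longlongrightarrow> deriv P (z s) - p1 s) (at s)" by (intro tendsto_diff cp)
      from that False consider "P (z s) - p s \<noteq> 0" | "deriv P (z s) - p1 s \<noteq> 0" by (auto simp: S_def)
      then show ?thesis
      proof cases
        case 1
        show ?thesis using tendsto_imp_eventually_ne[OF l1 1] by eventually_elim (auto simp: S_def)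
      next
        case 2
        show ?thesis using tendsto_imp_eventually_ne[OF l2 2] by eventually_elim (auto simp: S_def)
      qed
    qed
    then have "\<not> s islimpt S" if "s \<notin> S" for s
      using that by (auto simp: islimpt_iff_eventually)
    then show ?thesis unfolding closed_limpt by blast
  qed
  ultimately have "S = {} \<or> S = UNIV" using clopen[of S] by blast
  moreover have "t0 \<in> S" using i by (simp add: S_def z_def)
  ultimately have "t \<in> S" by auto
  then show ?thesis by (simp add: S_def z_def)
qed

subsection \<open>The equation of motion\<close>

text \<open>The same symbol denotes vector components; with both readings the formulas below are ambiguous.\<close>

no_notation fps_nth (infixl "$" 75)

section \<open>Tangent vectors and the representation of covectors\<close>

lemma ip_tproj:
  assumes "v \<in> tspace \<sigma> p"
  shows "ip \<sigma> (tproj \<sigma> p w) v = ip \<sigma> w v"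
proof -
  have "ip \<sigma> (tproj \<sigma> p w) v = ip \<sigma> w v - \<sigma> * ip \<sigma> p w * ip \<sigma> p v"
    by (simp add: ip_def tproj_def algebra_simps)
  then show ?thesis using assms by (simp add: tspace_def)
qed

lemma ip_commute: "ip \<sigma> v w = ip \<sigma> w v"
  by (simp add: ip_def)

lemma tproj_in_tspace:
  assumes "\<sigma> = 1 \<or> \<sigma> = -1" "p \<in> Msig \<sigma>"
  shows "tproj \<sigma> p w \<in> tspace \<sigma> p"
proof -
  have "ip \<sigma> p (tproj \<sigma> p w) = ip \<sigma> p w - \<sigma> * ip \<sigma> p w * ip \<sigma> p p"
    by (simp add: ip_def tproj_def algebra_simps)
  then show ?thesis using assms by (auto simp: tspace_def Msig_def)
qed

text \<open>Pairing with a tangent vector sees only the tangential part of \<open>w\<close>, so the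
  equality extends from tangent \<open>w\<close> to all vectors. Nondegeneracy of the ambient form
  then decides, for either sign of \<sigma>.\<close>

lemma tspace_nondegenerate:
  assumes s: "\<sigma> = 1 \<or> \<sigma> = -1" and p: "p \<in> Msig \<sigma>" and u: "u \<in> tspace \<sigma> p" "v \<in> tspace \<sigma> p"
    and eq: "\<And>w. w \<in> tspace \<sigma> p \<Longrightarrow> ip \<sigma> u w = ip \<sigma> v w"
  shows "u = v"
proof -
  have "ip \<sigma> u w = ip \<sigma> v w" for w
    using eq[OF tproj_in_tspace[OF s p, of w]] ip_tproj[OF u(1), of w] ip_tproj[OF u(2), of w]
    by (simp add: ip_commute)
  from this[of "vector [1, 0, 0]"] this[of "vector [0, 1, 0]"] this[of "vector [0, 0, 1]"]
  show ?thesis using s by (auto simp: ip_def vec_eq_iff forall_3 vector_3)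
qed

text \<open>Evaluates the definite descriptions in both \<open>rgrad\<close> and
  \<open>theta_sharp\<close>: any ambient vector that represents the covector on tangent vectors
  will do, once it is projected.\<close>

lemma the_tangent_representative:
  assumes s: "\<sigma> = 1 \<or> \<sigma> = -1" and p: "p \<in> Msig \<sigma>"
    and \<phi>: "\<And>w. w \<in> tspace \<sigma> p \<Longrightarrow> \<phi> w = ip \<sigma> u w"
  shows "(THE v. v \<in> tspace \<sigma> p \<and> (\<forall>w\<in>tspace \<sigma> p. ip \<sigma> v w = \<phi> w)) = tproj \<sigma> p u"
proof (rule the_equality)
  show *: "tproj \<sigma> p u \<in> tspace \<sigma> p \<and> (\<forall>w\<in>tspace \<sigma> p. ip \<sigma> (tproj \<sigma> p u) w = \<phi> w)"
    using tproj_in_tspace[OF s p] ip_tproj \<phi> by simp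
  fix v assume "v \<in> tspace \<sigma> p \<and> (\<forall>w\<in>tspace \<sigma> p. ip \<sigma> v w = \<phi> w)"
  then show "v = tproj \<sigma> p u" using * by (intro tspace_nondegenerate[OF s p]) auto
qed

section \<open>The gradient term and the magnetic term of the field A\<close>

definition dAfield :: "real \<Rightarrow> real \<Rightarrow> real^3 \<Rightarrow> real^3 \<Rightarrow> real^3" where
  "dAfield \<beta> \<gamma> y h = \<beta> *\<^sub>R Bfield h - \<gamma> *\<^sub>R (h$3 *\<^sub>R y + y$3 *\<^sub>R h)"

lemma bounded_linear_Bfield: "bounded_linear Bfield"
  unfolding linear_conv_bounded_linear[symmetric]
  by (rule linearI) (simp_all add: Bfield_def vec_eq_iff forall_3 vector_3)

lemma has_derivative_Afield: "(Afield \<beta> \<gamma> has_derivative dAfield \<beta> \<gamma> y) (at y)"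
proof -
  have B: "(Bfield has_derivative Bfield) (at y)"
    by (rule bounded_linear_imp_has_derivative[OF bounded_linear_Bfield])
  have n: "((\<lambda>y::real^3. y$3) has_derivative (\<lambda>h. h$3)) (at y)"
    by (rule bounded_linear_imp_has_derivative[OF bounded_linear_vec_nth])
  have "((\<lambda>y::real^3. y$3 *\<^sub>R y) has_derivative (\<lambda>h. y$3 *\<^sub>R h + h$3 *\<^sub>R y)) (at y)"
    by (rule has_derivative_scaleR[OF n has_derivative_ident])
  from has_derivative_diff[OF has_derivative_const this]
  have C: "(Cfield has_derivative (\<lambda>h. 0 - (y$3 *\<^sub>R h + h$3 *\<^sub>R y))) (at y)"
    unfolding Cfield_def[abs_def] .
  from has_derivative_add[OF has_derivative_scaleR_right[OF B] has_derivative_scaleR_right[OF C]]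
  show ?thesis
    unfolding Afield_def[abs_def] dAfield_def[abs_def]
    by (rule has_derivative_eq_rhs) (simp add: fun_eq_iff algebra_simps)
qed

lemma frechet_Afield: "frechet_derivative (Afield \<beta> \<gamma>) (at y) = dAfield \<beta> \<gamma> y"
  using frechet_derivative_at[OF has_derivative_Afield] by simp

lemma bounded_bilinear_ip: "bounded_bilinear (ip \<sigma>)"
proof -
  have "bilinear (ip \<sigma>)"
    unfolding bilinear_def by (intro conjI allI linearI) (simp_all add: ip_def algebra_simps)
  then show ?thesis by (simp add: bilinear_conv_bounded_bilinear)
qed

lemma frechet_half_norm_Afield:
  "frechet_derivative (\<lambda>y. (1/2) * ip \<sigma> (Afield \<beta> \<gamma> y) (Afield \<beta> \<gamma> y)) (at y) w = ip \<sigma> (Afield \<beta> \<gamma> y) (dAfield \<beta> \<gamma> y w)"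
proof -
  have "((\<lambda>y. (1/2) * ip \<sigma> (Afield \<beta> \<gamma> y) (Afield \<beta> \<gamma> y)) has_derivative
      (\<lambda>w. (1/2) * (ip \<sigma> (Afield \<beta> \<gamma> y) (dAfield \<beta> \<gamma> y w) + ip \<sigma> (dAfield \<beta> \<gamma> y w) (Afield \<beta> \<gamma> y)))) (at y)"
    by (intro has_derivative_mult_right bounded_bilinear.FDERIV[OF bounded_bilinear_ip] has_derivative_Afield)
  from frechet_derivative_at[OF this, symmetric] show ?thesis
    by (simp add: ip_commute[of \<sigma> "dAfield \<beta> \<gamma> y w"])
qed

text \<open>On M the fields B and C are orthogonal with the same squared norm \<sigma> (1 - y_3^2).
  Hence ||A||^2 / 2 equals \<sigma> (\<beta>^2 + \<gamma>^2)(1 - y_3^2) / 2, whose differential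
  along M is the pairing with the vertical vector on the right.\<close>

lemma ip_Afield_dAfield:
  assumes s: "\<sigma> = 1 \<or> \<sigma> = -1" and y: "y \<in> Msig \<sigma>" and w: "w \<in> tspace \<sigma> y"
  shows "ip \<sigma> (Afield \<beta> \<gamma> y) (dAfield \<beta> \<gamma> y w) = ip \<sigma> (vector [0, 0, - (\<beta>^2 + \<gamma>^2) * y$3]) w"
proof -
  have M: "y$1 * y$1 + y$2 * y$2 + \<sigma> * y$3 * y$3 = \<sigma>" using y by (simp add: Msig_def ip_def)
  have T: "y$1 * w$1 + y$2 * w$2 + \<sigma> * y$3 * w$3 = 0" using w by (simp add: tspace_def ip_def)
  \<comment> \<open>A polynomial identity free of side conditions, arranged so that its last two
    brackets are the left-hand sides of \<open>M\<close> and \<open>T\<close>.\<close>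
  have c: "ip \<sigma> (Afield \<beta> \<gamma> y) (dAfield \<beta> \<gamma> y w) =
      \<beta>^2 * (y$1 * w$1 + y$2 * w$2) - \<gamma>^2 * \<sigma> * (y$3 * w$3 + y$3 * w$3)
      + \<gamma>^2 * y$3 * w$3 * (y$1 * y$1 + y$2 * y$2 + \<sigma> * y$3 * y$3)
      + \<gamma>^2 * y$3 * y$3 * (y$1 * w$1 + y$2 * w$2 + \<sigma> * y$3 * w$3)"
    unfolding ip_def Afield_def dAfield_def Bfield_def Cfield_def vector_add_component vector_minus_component
      vector_scaleR_component vector_3 real_scaleR_def
    by algebra
  have "y$1 * w$1 + y$2 * w$2 = - (\<sigma> * y$3 * w$3)" using T by simp
  then show ?thesis unfolding c M T by (simp add: ip_def vector_3 algebra_simps)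
qed

lemma rgrad_half_norm_Afield:
  assumes s: "\<sigma> = 1 \<or> \<sigma> = -1" and y: "y \<in> Msig \<sigma>"
  shows "rgrad \<sigma> (\<lambda>y. (1/2) * ip \<sigma> (Afield \<beta> \<gamma> y) (Afield \<beta> \<gamma> y)) y
    = tproj \<sigma> y (vector [0, 0, - (\<beta>^2 + \<gamma>^2) * y$3])"
  unfolding rgrad_def frechet_half_norm_Afield
  by (rule the_tangent_representative[OF s y ip_Afield_dAfield[OF s y]])

text \<open>C pairs with a tangent vector Y to \<sigma> Y_3, so its 1-form is the differential of
  \<sigma> y_3; it is closed, and \<gamma> drops out. B is a skew linear map, so the
  antisymmetrisation doubles its contribution.\<close>

lemma theta_sharp_Afield:
  assumes s: "\<sigma> = 1 \<or> \<sigma> = -1" and y: "y \<in> Msig \<sigma>" and X: "X \<in> tspace \<sigma> y"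
  shows "theta_sharp \<sigma> (Afield \<beta> \<gamma>) y X = tproj \<sigma> y ((2 * \<beta>) *\<^sub>R Bfield X)"
  unfolding theta_sharp_def
proof (rule the_tangent_representative[OF s y])
  fix Y assume Y: "Y \<in> tspace \<sigma> y"
  have "theta \<sigma> (Afield \<beta> \<gamma>) y X Y = ip \<sigma> (dAfield \<beta> \<gamma> y X) Y - ip \<sigma> (dAfield \<beta> \<gamma> y Y) X"
    by (simp add: theta_def cov_def frechet_Afield ip_tproj X Y)
  also have "\<dots> = ip \<sigma> ((2 * \<beta>) *\<^sub>R Bfield X) Y - \<gamma> * (X$3 * ip \<sigma> y Y - Y$3 * ip \<sigma> y X)"
    by (simp add: ip_def dAfield_def Bfield_def vector_3 algebra_simps)
  finally show "theta \<sigma> (Afield \<beta> \<gamma>) y X Y = ip \<sigma> ((2 * \<beta>) *\<^sub>R Bfield X) Y"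
    using X Y by (simp add: tspace_def)
qed

lemma tproj_eq_components:
  assumes "tproj \<sigma> p u = tproj \<sigma> p v"
  obtains l where "u - v = l *\<^sub>R p" "l = \<sigma> * ip \<sigma> p (u - v)"
proof (rule that[OF _ refl])
  have *: "ip \<sigma> p (u - v) = ip \<sigma> p u - ip \<sigma> p v" by (simp add: ip_def algebra_simps)
  show "u - v = (\<sigma> * ip \<sigma> p (u - v)) *\<^sub>R p"
    unfolding * using assms by (simp add: tproj_def algebra_simps)
qed

lemma tproj_add: "tproj \<sigma> p u + tproj \<sigma> p v = tproj \<sigma> p (u + v)"
  by (simp add: tproj_def ip_def algebra_simps)

text \<open>The third component decouples because the Lagrange multiplier of the constraint depends,
  apart from z, only on speed and angular momentum, which the conserved quantities eliminate. The
  terms in \<beta>^2 cancel, leaving \<beta> explicitly only in 2 \<beta> c.\<close>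

lemma magnetic_scalar_equations:
  fixes \<sigma> \<beta> \<gamma> :: real
    and x x' x'' :: "real \<Rightarrow> real^3"
  assumes sigma: "\<sigma> = 1 \<or> \<sigma> = -1"
    and onM: "\<forall>t. x t \<in> Msig \<sigma>"
    and d1: "\<forall>t. (x has_vector_derivative x' t) (at t)"
    and d2: "\<forall>t. (x' has_vector_derivative x'' t) (at t)"
    and eqn: "\<forall>t. tproj \<sigma> (x t) (x'' t) =
                 rgrad \<sigma> (\<lambda>y. (1/2) * ip \<sigma> (Afield \<beta> \<gamma> y) (Afield \<beta> \<gamma> y)) (x t)
                 + theta_sharp \<sigma> (Afield \<beta> \<gamma>) (x t) (x' t)"
  defines "b \<equiv> \<sigma> * ip \<sigma> (x' 0) (x' 0) - (\<beta>^2 + \<gamma>^2) * (1 - (x 0 $ 3)^2)"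
    and "c \<equiv> \<sigma> * (x 0 $ 1 * x' 0 $ 2 - x 0 $ 2 * x' 0 $ 1) - \<beta> * (1 - (x 0 $ 3)^2)"
  shows "x'' t $ 3 = (2 * \<beta> * c - b - 2 * \<gamma>^2) * x t $ 3 + 2 * \<gamma>^2 * (x t $ 3)^3"
proof -
  have ss: "\<sigma> * \<sigma> = 1" using sigma by auto
  have comp1: "((\<lambda>t. x t $ i) has_real_derivative x' t $ i) (at t)" for i t
    using bounded_linear.has_vector_derivative[OF bounded_linear_vec_nth d1[rule_format]]
    by (simp add: has_real_derivative_iff_has_vector_derivative)
  have comp2: "((\<lambda>t. x' t $ i) has_real_derivative x'' t $ i) (at t)" for i t
    using bounded_linear.has_vector_derivative[OF bounded_linear_vec_nth d2[rule_format]]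
    by (simp add: has_real_derivative_iff_has_vector_derivative)
  define u v z where "u = (\<lambda>t. x t $ 1)" and "v = (\<lambda>t. x t $ 2)" and "z = (\<lambda>t. x t $ 3)"
  define u1 v1 z1 where "u1 = (\<lambda>t. x' t $ 1)" and "v1 = (\<lambda>t. x' t $ 2)" and "z1 = (\<lambda>t. x' t $ 3)"
  define u2 v2 z2 where "u2 = (\<lambda>t. x'' t $ 1)" and "v2 = (\<lambda>t. x'' t $ 2)" and "z2 = (\<lambda>t. x'' t $ 3)"
  have D: "(u has_real_derivative u1 t) (at t)" "(v has_real_derivative v1 t) (at t)" "(z has_real_derivative z1 t) (at t)"
    "(u1 has_real_derivative u2 t) (at t)" "(v1 has_real_derivative v2 t) (at t)" "(z1 has_real_derivative z2 t) (at t)" for t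
    using comp1 comp2 unfolding u_def v_def z_def u1_def v1_def z1_def u2_def v2_def z2_def by blast+
  have M: "u t * u t + v t * v t + \<sigma> * z t * z t = \<sigma>" for t
    using onM[rule_format, of t] by (simp add: Msig_def ip_def u_def v_def z_def)
  have "((\<lambda>t. u t * u t + v t * v t + \<sigma> * z t * z t) has_real_derivative
      2 * (u t * u1 t + v t * v1 t + \<sigma> * z t * z1 t)) (at t)" for t
    by (auto intro!: derivative_eq_intros D simp: algebra_simps)
  then have T0: "((\<lambda>t. \<sigma>) has_real_derivative 2 * (u t * u1 t + v t * v1 t + \<sigma> * z t * z1 t)) (at t)" for t
    unfolding M .
  have T: "u t * u1 t + v t * v1 t + \<sigma> * z t * z1 t = 0" for t
    using DERIV_unique[OF T0[of t] DERIV_const] unfolding mult_eq_0_iff[of 2] by simp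
  have "((\<lambda>t. u t * u1 t + v t * v1 t + \<sigma> * z t * z1 t) has_real_derivative
      (u1 t * u1 t + v1 t * v1 t + \<sigma> * z1 t * z1 t) + (u t * u2 t + v t * v2 t + \<sigma> * z t * z2 t)) (at t)" for t
    by (auto intro!: derivative_eq_intros D simp: algebra_simps)
  then have N0: "((\<lambda>t. 0) has_real_derivative
      (u1 t * u1 t + v1 t * v1 t + \<sigma> * z1 t * z1 t) + (u t * u2 t + v t * v2 t + \<sigma> * z t * z2 t)) (at t)" for t
    unfolding T .
  have N: "(u1 t * u1 t + v1 t * v1 t + \<sigma> * z1 t * z1 t) + (u t * u2 t + v t * v2 t + \<sigma> * z t * z2 t) = 0" for t
    using DERIV_unique[OF N0[of t] DERIV_const] .
  \<comment> \<open>The multiplier of the normal vector \<open>x t\<close>: pair the equation of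
    motion with \<open>x t\<close> and use \<open>N\<close> to express the pairing of
    \<open>x t\<close> with \<open>x'' t\<close> through the velocity.\<close>
  define l where "l = (\<lambda>t. - \<sigma> * (u1 t * u1 t + v1 t * v1 t + \<sigma> * z1 t * z1 t) + (\<beta>^2 + \<gamma>^2) * z t * z t
      + 2 * \<beta> * \<sigma> * (u t * v1 t - v t * u1 t))"
  have E: "u2 t = l t * u t - 2 * \<beta> * v1 t" "v2 t = l t * v t + 2 * \<beta> * u1 t"
    "z2 t = l t * z t - (\<beta>^2 + \<gamma>^2) * z t" for t
  proof -
    have X: "x' t \<in> tspace \<sigma> (x t)"
      using T[of t] by (simp add: tspace_def ip_def u_def v_def z_def u1_def v1_def z1_def)
    define F where "F = vector [0, 0, - (\<beta>^2 + \<gamma>^2) * x t $ 3] + (2 * \<beta>) *\<^sub>R Bfield (x' t)"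
    have "tproj \<sigma> (x t) (x'' t) = tproj \<sigma> (x t) F"
      using eqn[rule_format, of t] unfolding F_def
      by (simp only: rgrad_half_norm_Afield[OF sigma onM[rule_format]]
          theta_sharp_Afield[OF sigma onM[rule_format] X] tproj_add)
    then obtain m where m: "x'' t - F = m *\<^sub>R x t" "m = \<sigma> * ip \<sigma> (x t) (x'' t - F)"
      by (rule tproj_eq_components)
    have F: "F $ 1 = - 2 * \<beta> * v1 t" "F $ 2 = 2 * \<beta> * u1 t" "F $ 3 = - (\<beta>^2 + \<gamma>^2) * z t"
      by (simp_all add: F_def Bfield_def vector_3 u1_def v1_def z_def)
    have "m = \<sigma> * (u t * (u2 t - F $ 1) + v t * (v2 t - F $ 2) + \<sigma> * z t * (z2 t - F $ 3))"
      unfolding m(2) by (simp add: ip_def u_def v_def z_def u2_def v2_def z2_def)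
    also have "\<dots> = \<sigma> * (u t * u2 t + v t * v2 t + \<sigma> * z t * z2 t)
        + (\<sigma> * \<sigma>) * (\<beta>^2 + \<gamma>^2) * z t * z t + 2 * \<beta> * \<sigma> * (u t * v1 t - v t * u1 t)"
      unfolding F by (simp add: algebra_simps)
    also have "u t * u2 t + v t * v2 t + \<sigma> * z t * z2 t = - (u1 t * u1 t + v1 t * v1 t + \<sigma> * z1 t * z1 t)"
      using N[of t] by linarith
    finally have ml: "m = l t" by (simp only: l_def ss mult_1 mult_minus_left mult_minus_right)
    have "x'' t $ i - F $ i = m * x t $ i" for i
      using arg_cong[OF m(1), of "\<lambda>w. w $ i"] by simp
    from this[of 1] this[of 2] this[of 3]
    show "u2 t = l t * u t - 2 * \<beta> * v1 t" "v2 t = l t * v t + 2 * \<beta> * u1 t"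
      "z2 t = l t * z t - (\<beta>^2 + \<gamma>^2) * z t"
      unfolding F ml u2_def v2_def z2_def u_def v_def z_def by (simp_all add: algebra_simps)
  qed
  \<comment> \<open>In terms of the fields, \<open>bb\<close> is \<sigma> (||x'||^2 - ||A||^2), an
    energy to which the magnetic force contributes no work, and \<open>cc\<close> is \<sigma> <B, x'
    - A>, the momentum belonging to rotations about the third axis.\<close>
  define bb where "bb = (\<lambda>t. \<sigma> * (u1 t * u1 t + v1 t * v1 t + \<sigma> * z1 t * z1 t) - (\<beta>^2 + \<gamma>^2) * (1 - z t * z t))"
  define cc where "cc = (\<lambda>t. \<sigma> * (u t * v1 t - v t * u1 t) - \<beta> * (1 - z t * z t))"
  have "(bb has_real_derivative 0) (at t)" for t
  proof -
    have "(bb has_real_derivative 2 * \<sigma> * (u1 t * u2 t + v1 t * v2 t + \<sigma> * z1 t * z2 t) + 2 * (\<beta>^2 + \<gamma>^2) * z t * z1 t) (at t)"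
      unfolding bb_def by (auto intro!: derivative_eq_intros D simp: algebra_simps)
    also have "2 * \<sigma> * (u1 t * u2 t + v1 t * v2 t + \<sigma> * z1 t * z2 t) + 2 * (\<beta>^2 + \<gamma>^2) * z t * z1 t
        = 2 * \<sigma> * l t * (u t * u1 t + v t * v1 t + \<sigma> * z t * z1 t) + 2 * (1 - \<sigma> * \<sigma>) * (\<beta>^2 + \<gamma>^2) * z t * z1 t"
      unfolding E by (simp add: algebra_simps)
    finally show ?thesis by (simp add: T ss)
  qed
  then have bb: "bb t = bb 0" by (intro DERIV_isconst_all) blast
  have "(cc has_real_derivative 0) (at t)" for t
  proof -
    have "(cc has_real_derivative \<sigma> * (u t * v2 t - v t * u2 t) + 2 * \<beta> * z t * z1 t) (at t)"
      unfolding cc_def by (auto intro!: derivative_eq_intros D simp: algebra_simps)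
    also have "\<sigma> * (u t * v2 t - v t * u2 t) + 2 * \<beta> * z t * z1 t
        = 2 * \<beta> * \<sigma> * (u t * u1 t + v t * v1 t + \<sigma> * z t * z1 t) + 2 * (1 - \<sigma> * \<sigma>) * \<beta> * z t * z1 t"
      unfolding E by (simp add: algebra_simps)
    finally show ?thesis by (simp add: T ss)
  qed
  then have cc: "cc t = cc 0" by (intro DERIV_isconst_all) blast
  have "bb 0 = b" "cc 0 = c"
    by (simp_all add: bb_def cc_def b_def c_def ip_def u_def v_def z_def u1_def v1_def z1_def power2_eq_square)
  with bb cc have "\<sigma> * (u1 t * u1 t + v1 t * v1 t + \<sigma> * z1 t * z1 t) = b + (\<beta>^2 + \<gamma>^2) * (1 - z t * z t)"
    "\<sigma> * (u t * v1 t - v t * u1 t) = c + \<beta> * (1 - z t * z t)"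
    by (simp_all add: bb_def cc_def)
  then have lt: "l t = - (b + (\<beta>^2 + \<gamma>^2) * (1 - z t * z t)) + (\<beta>^2 + \<gamma>^2) * z t * z t + 2 * \<beta> * (c + \<beta> * (1 - z t * z t))"
    by (simp add: l_def mult.assoc)
  have "z2 t = (2 * \<beta> * c - b - 2 * \<gamma>^2) * z t + 2 * \<gamma>^2 * (z t)^3"
    unfolding E lt by (simp add: algebra_simps power2_eq_square power3_eq_cube)
  then show ?thesis by (simp add: z2_def z_def)
qed

lemma duffing_weierstrass:
  fixes z z1 :: "real \<Rightarrow> real" and \<gamma> \<delta> :: real
  assumes gamma: "\<gamma> \<noteq> 0"
    and z: "\<And>t. (z has_real_derivative z1 t) (at t)"
    and z1: "\<And>t. (z1 has_real_derivative 3 * \<gamma>^2 * \<delta> * z t + 2 * \<gamma>^2 * (z t)^3) (at t)"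
    and nonconst: "\<not> (\<exists>k. \<forall>t. z t = k)"
  shows "\<exists>a::complex. \<exists>d::real. \<forall>t. complex_of_real ((z t)^2) =
    wp (complex_of_real (12 * \<delta>^2 + d)) (complex_of_real (- 8 * \<delta>^3 - \<delta> * d)) (complex_of_real (\<gamma> * t) + a)
    - complex_of_real \<delta>"
proof -
  define I where "I = (\<lambda>t. (z1 t)^2 - \<gamma>^2 * (z t)^4 - 3 * \<gamma>^2 * \<delta> * (z t)^2)"
  \<comment> \<open>The constant of integration, scaled so that \<gamma>^2 factors out of the first
    integral and \<open>g2\<close> takes the form 12 \<delta>^2 + d.\<close>
  define d where "d = - 4 * I 0 / \<gamma>^2"
  define g2 g3 where "g2 = complex_of_real (12 * \<delta>^2 + d)" and "g3 = complex_of_real (- 8 * \<delta>^3 - \<delta> * d)"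
  have "(I has_real_derivative 0) (at t)" for t
    unfolding I_def by (auto intro!: derivative_eq_intros z z1 simp: algebra_simps power2_eq_square power3_eq_cube)
  then have I: "I t = I 0" for t by (intro DERIV_isconst_all) blast
  have first: "(z1 t)^2 = \<gamma>^2 * ((z t)^4 + 3 * \<delta> * (z t)^2 - d / 4)" for t
  proof -
    have "(z1 t)^2 = \<gamma>^2 * (z t)^4 + 3 * \<gamma>^2 * \<delta> * (z t)^2 + I t" by (simp add: I_def)
    moreover have "I t = - (\<gamma>^2 * d / 4)" unfolding I[of t] using gamma by (simp add: d_def)
    ultimately show ?thesis by (simp add: algebra_simps)
  qed
  \<comment> \<open>A time with p' nonzero, as \<open>wgerm_attains\<close> demands. If z z'
    vanished identically, z^2 and then z would be constant.\<close>
  obtain t0 where t0: "z t0 * z1 t0 \<noteq> 0"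
  proof (rule ccontr)
    assume "\<not> thesis"
    then have zz: "z t * z1 t = 0" for t using that by blast
    have "((\<lambda>t. (z t)^2) has_real_derivative 0) (at t)" for t
      using DERIV_mult[OF z[of t] z[of t]] zz[of t] by (simp add: power2_eq_square mult.commute)
    then have c: "(z t)^2 = (z 0)^2" for t by (intro DERIV_isconst_all[of "\<lambda>t. (z t)^2"]) blast
    have "\<exists>k. \<forall>t. z t = k"
    proof (cases "z 0 = 0")
      case True
      then show ?thesis using c by auto
    next
      case False
      then have "z t \<noteq> 0" for t using c[of t] by auto
      then have "z1 t = 0" for t using zz[of t] by simp
      then have "(z has_real_derivative 0) (at t)" for t using z[of t] by simp
      then have "z t = z 0" for t by (intro DERIV_isconst_all) blast
      then show ?thesis by blast
    qed
    then show False using nonconst by blast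
  qed
  \<comment> \<open>Rescaling time by \<gamma> normalises the leading coefficient of the cubic to
    4.\<close>
  define p where "p = (\<lambda>s. (z (s / \<gamma>))^2 + \<delta>)"
  define p1 where "p1 = (\<lambda>s. 2 * z (s / \<gamma>) * z1 (s / \<gamma>) / \<gamma>)"
  have zs: "((\<lambda>s. z (s / \<gamma>)) has_real_derivative z1 (s / \<gamma>) * (1 / \<gamma>)) (at s)"
    and z1s: "((\<lambda>s. z1 (s / \<gamma>)) has_real_derivative (3 * \<gamma>^2 * \<delta> * z (s / \<gamma>) + 2 * \<gamma>^2 * (z (s / \<gamma>))^3) * (1 / \<gamma>)) (at s)" for s
    by (rule DERIV_chain2[OF z] DERIV_chain2[OF z1], rule DERIV_cdivide[OF DERIV_ident])+
  have dp: "(p has_real_derivative p1 s) (at s)" for s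
    unfolding p_def p1_def by (auto intro!: derivative_eq_intros zs)
  have dp1: "(p1 has_real_derivative 6 * (p s)^2 - (12 * \<delta>^2 + d) / 2) (at s)" for s
  proof -
    let ?z = "z (s / \<gamma>)" and ?z1 = "z1 (s / \<gamma>)"
    have "(p1 has_real_derivative (2 * (?z1)^2 / \<gamma>^2 + 2 * ?z * (3 * \<delta> * ?z + 2 * ?z^3))) (at s)"
      unfolding p1_def using gamma
      by (auto intro!: derivative_eq_intros zs z1s simp: field_simps power2_eq_square)
    also have "2 * (?z1)^2 / \<gamma>^2 + 2 * ?z * (3 * \<delta> * ?z + 2 * ?z^3) = 6 * (p s)^2 - (12 * \<delta>^2 + d) / 2"
      unfolding first p_def using gamma by (simp add: field_simps eval_nat_numeral)
    finally show ?thesis .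
  qed
  define s0 where "s0 = \<gamma> * t0"
  have "s0 / \<gamma> = t0" using gamma by (simp add: s0_def)
  then have p1n: "p1 s0 \<noteq> 0" using t0 gamma by (simp add: p1_def)
  have "(p1 s0)^2 = 4 * (z (s0 / \<gamma>))^2 * ((z1 (s0 / \<gamma>))^2 / \<gamma>^2)"
    by (simp add: p1_def power_divide power_mult_distrib)
  also have "\<dots> = 4 * (p s0)^3 - (12 * \<delta>^2 + d) * p s0 - (- 8 * \<delta>^3 - \<delta> * d)"
    unfolding first p_def using gamma by (simp add: field_simps eval_nat_numeral)
  finally have cub: "(p1 s0)^2 = 4 * (p s0)^3 - (12 * \<delta>^2 + d) * p s0 - (- 8 * \<delta>^3 - \<delta> * d)" .
  have cub': "(complex_of_real (p1 s0))^2 = wcub g2 g3 (complex_of_real (p s0))"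
    using arg_cong[OF cub, of complex_of_real] by (simp add: wcub_def g2_def g3_def)
  have P: "wp g2 g3 nicely_meromorphic_on UNIV" "wgerm g2 g3 (wp g2 g3)"
    using is_weierstrass_p_wp[of g2 g3] by (simp_all add: is_weierstrass_p_iff)
  have "complex_of_real (p1 s0) \<noteq> 0" using p1n by simp
  then obtain a where a: "\<not> is_pole (wp g2 g3) a" "wp g2 g3 a = complex_of_real (p s0)"
    "deriv (wp g2 g3) a = complex_of_real (p1 s0)"
    by (rule wgerm_attains[OF P cub'])
  \<comment> \<open>The shift a - s0 makes the argument equal to \<open>a\<close> at s = s0, where
    value and derivative were matched.\<close>
  have "wp g2 g3 (a - of_real s0 + of_real s) = complex_of_real (p s)" for s
  proof (rule wgerm_real_solution[OF P, where ?p1.0 = "\<lambda>s. complex_of_real (p1 s)" and ?t0.0 = s0])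
    show "((\<lambda>s. complex_of_real (p s)) has_vector_derivative complex_of_real (p1 t)) (at t)" for t
      by (rule has_vector_derivative_of_real) (use dp in \<open>simp add: has_real_derivative_iff_has_vector_derivative\<close>)
    have "((\<lambda>s. complex_of_real (p1 s)) has_vector_derivative complex_of_real (6 * (p t)^2 - (12 * \<delta>^2 + d) / 2)) (at t)" for t
      by (rule has_vector_derivative_of_real) (use dp1 in \<open>simp add: has_real_derivative_iff_has_vector_derivative\<close>)
    then show "((\<lambda>s. complex_of_real (p1 s)) has_vector_derivative 6 * (complex_of_real (p t))^2 - g2 / 2) (at t)" for t
      by (simp add: g2_def)
  qed (use a in simp_all)
  from this[of "\<gamma> * t" for t]
  have "complex_of_real ((z t)^2) = wp g2 g3 (complex_of_real (\<gamma> * t) + (a - of_real s0)) - complex_of_real \<delta>" for t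
    using gamma by (simp add: p_def add.commute)
  then show ?thesis unfolding g2_def g3_def by blast
qed

theorem theorem7:
  fixes \<sigma> \<beta> \<gamma> :: real
    and x x' x'' :: "real \<Rightarrow> real^3"
  assumes sigma: "\<sigma> = 1 \<or> \<sigma> = -1"
    and gamma: "\<gamma> \<noteq> 0"
    and onM: "\<forall>t. x t \<in> Msig \<sigma>"
    and d1: "\<forall>t. (x has_vector_derivative x' t) (at t)"
    and d2: "\<forall>t. (x' has_vector_derivative x'' t) (at t)"
    and C2: "continuous_on UNIV x''"
    and eqn: "\<forall>t. tproj \<sigma> (x t) (x'' t) =
                 rgrad \<sigma> (\<lambda>y. (1/2) * ip \<sigma> (Afield \<beta> \<gamma> y) (Afield \<beta> \<gamma> y)) (x t)
                 + theta_sharp \<sigma> (Afield \<beta> \<gamma>) (x t) (x' t)"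
    and nonconst: "\<not> (\<exists>k. \<forall>t. x t $ 3 = k)"
  shows "let b = \<sigma> * ip \<sigma> (x' 0) (x' 0) - (\<beta>^2 + \<gamma>^2) * (1 - (x 0 $ 3)^2);
             c = \<sigma> * (x 0 $ 1 * x' 0 $ 2 - x 0 $ 2 * x' 0 $ 1) - \<beta> * (1 - (x 0 $ 3)^2);
             \<delta> = (2 * \<beta> * c - b - 2 * \<gamma>^2) / (3 * \<gamma>^2)
         in \<exists>a::complex. \<exists>d::real.
              \<forall>t. complex_of_real ((x t $ 3)^2) =
                  wp (complex_of_real (12 * \<delta>^2 + d)) (complex_of_real (- 8 * \<delta>^3 - \<delta> * d))
                     (complex_of_real (\<gamma> * t) + a) - complex_of_real \<delta>"
proof -
  define b where "b = \<sigma> * ip \<sigma> (x' 0) (x' 0) - (\<beta>^2 + \<gamma>^2) * (1 - (x 0 $ 3)^2)"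
  define c where "c = \<sigma> * (x 0 $ 1 * x' 0 $ 2 - x 0 $ 2 * x' 0 $ 1) - \<beta> * (1 - (x 0 $ 3)^2)"
  define \<delta> where "\<delta> = (2 * \<beta> * c - b - 2 * \<gamma>^2) / (3 * \<gamma>^2)"
  \<comment> \<open>The denominator 3 \<gamma>^2 in \<delta> gives the linear coefficient the form 3
    \<gamma>^2 \<delta>, for which the shift of z^2 by \<delta> removes the quadratic term of the
    cubic.\<close>
  have \<delta>: "2 * \<beta> * c - b - 2 * \<gamma>^2 = 3 * \<gamma>^2 * \<delta>" using gamma by (simp add: \<delta>_def)
  have z: "((\<lambda>t. x t $ 3) has_real_derivative x' t $ 3) (at t)" for t
    using bounded_linear.has_vector_derivative[OF bounded_linear_vec_nth d1[rule_format]]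
    by (simp add: has_real_derivative_iff_has_vector_derivative)
  have dz: "((\<lambda>t. x' t $ 3) has_real_derivative x'' t $ 3) (at t)" for t
    using bounded_linear.has_vector_derivative[OF bounded_linear_vec_nth d2[rule_format]]
    by (simp add: has_real_derivative_iff_has_vector_derivative)
  have z1: "((\<lambda>t. x' t $ 3) has_real_derivative 3 * \<gamma>^2 * \<delta> * x t $ 3 + 2 * \<gamma>^2 * (x t $ 3)^3) (at t)" for t
    using dz[of t] magnetic_scalar_equations[OF sigma onM d1 d2 eqn, of t]
    unfolding b_def[symmetric] c_def[symmetric] \<delta> by simp
  show ?thesis
    unfolding Let_def b_def[symmetric] c_def[symmetric] \<delta>_def[symmetric]
    by (rule duffing_weierstrass[OF gamma z z1 nonconst])
qed

end
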